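(* For all $\tau\in\mathbb{H}^+$ the Jacobi theta-constants $\vartheta_2,\vartheta_3,\vartheta_4$ together with the Weierstrass function $\eta$ satisfy the closed differential identities $$\frac{d\vartheta_2}{d\tau}=\frac{i}{\pi}\Big\{\eta+\frac{\pi^2}{12}\big(\vartheta_3^4+\vartheta_4^4\big)\Big\}\vartheta_2,\qquad \frac{d\vartheta_3}{d\tau}=\frac{i}{\pi}\Big\{\eta+\frac{\pi^2}{12}\big(\vartheta_2^4-\vartheta_4^4\big)\Big\}\vartheta_3,$$ $$\frac{d\vartheta_4}{d\tau}=\frac{i}{\pi}\Big\{\eta-\frac{\pi^2}{12}\big(\vartheta_2^4+\vartheta_3^4\big)\Big\}\vartheta_4,\qquad \frac{d\eta}{d\tau}=\frac{i}{\pi}\Big\{2\eta^2-\frac{\pi^4}{12^2}\big(\vartheta_2^8+\vartheta_3^8+\vartheta_4^8\big)\Big\}.$$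
   Context: $\mathbb{H}^+=\{\tau\in\mathbb{C}:\operatorname{Im}\tau>0\}$. The functions are defined on $\mathbb{H}^+$ by the series $$\vartheta_2(\tau)=e^{\frac14\pi i\tau}\sum_{k=-\infty}^{\infty}e^{(k^2+k)\pi i\tau},\quad \vartheta_3(\tau)=\sum_{k=-\infty}^{\infty}e^{k^2\pi i\tau},\quad \vartheta_4(\tau)=\sum_{k=-\infty}^{\infty}(-1)^ke^{k^2\pi i\tau},$$ $$\eta(\tau)=2\pi^2\Big\{\frac1{24}-\sum_{k=1}^{\infty}\frac{e^{2k\pi i\tau}}{(1-e^{2k\pi i\tau})^2}\Big\}.$$ (This $\eta$ is the Weierstrass eta-function, not the Dedekind one.) *)

theory Defs
  imports "HOL-Analysis.Analysis"
begin

text \<open>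
  The functions below are meaningful only on the open upper half-plane, where all the series
  converge absolutely; hence the sums over all integers may be taken as unordered sums.
  Outside the half-plane their values carry no meaning.
\<close>

definition upper_half_plane :: "complex set" where
  "upper_half_plane = {\<tau>. Im \<tau> > 0}"

definition theta2 :: "complex \<Rightarrow> complex" where
  "theta2 \<tau> = exp (1/4 * of_real pi * \<i> * \<tau>) *
     (\<Sum>\<^sub>\<infinity>k\<in>(UNIV::int set). exp (of_int (k\<^sup>2 + k) * of_real pi * \<i> * \<tau>))"

definition theta3 :: "complex \<Rightarrow> complex" where
  "theta3 \<tau> = (\<Sum>\<^sub>\<infinity>k\<in>(UNIV::int set). exp (of_int (k\<^sup>2) * of_real pi * \<i> * \<tau>))"

definition theta4 :: "complex \<Rightarrow> complex" where
  "theta4 \<tau> =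
     (\<Sum>\<^sub>\<infinity>k\<in>(UNIV::int set). (-1) powi k * exp (of_int (k\<^sup>2) * of_real pi * \<i> * \<tau>))"

text \<open>
  This is the Weierstrass eta-function, not the Dedekind one. The series starts at 1, hence the
  index shift by \<open>Suc\<close>.
\<close>

definition weierstrass_eta :: "complex \<Rightarrow> complex" where
  "weierstrass_eta \<tau> = 2 * of_real pi ^ 2 *
     (1/24 - (\<Sum>k. exp (2 * of_nat (Suc k) * of_real pi * \<i> * \<tau>) /
                     (1 - exp (2 * of_nat (Suc k) * of_real pi * \<i> * \<tau>)) ^ 2))"

end

theory Submission
  imports Defs "HOL-Complex_Analysis.Cauchy_Integral_Formula" "HOL-Real_Asymp.Real_Asymp"
begin

text \<open>
  Write \<open>q = exp (\<pi> \<i> \<tau>)\<close> and let \<open>D\<close> be \<open>d/d\<tau>\<close> divided by \<open>\<pi> \<i>\<close>, so that \<open>D\<close> multiplies \<open>q\<^sup>s\<close> by \<open>s\<close>.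
  The proof avoids elliptic functions and modular transformations: everything comes from doubling
  the argument, \<open>\<tau> \<mapsto> 2\<tau>\<close>, apart from one product expansion that brings in the Lambert series of \<open>\<eta>\<close>.

  Every series is a moment \<open>\<Sum> \<epsilon>\<^sup>n (n + \<delta>)\<^sup>j q^((n + \<delta>)\<^sup>2)\<close>, and \<open>D\<close> raises \<open>j\<close> by 2. In a product of two such
  series the substitution \<open>(n, m) = (a + b, a - b)\<close> or \<open>(a + b + 1, a - b)\<close> turns \<open>n\<^sup>2 + m\<^sup>2\<close> into twice a
  sum of two squares, so the product splits into products of series at \<open>2\<tau>\<close>
  (\<open>has_sum_lattice_rotation\<close>). With \<open>\<phi> = \<Sum> (-1)\<^sup>n (n + 1/2) q^((n + 1/2)\<^sup>2)\<close> this gives, among others,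
  \<open>\<theta>\<^sub>3 \<theta>\<^sub>4 = \<theta>\<^sub>4(2\<tau>)\<^sup>2\<close>, \<open>\<theta>\<^sub>2\<^sup>2 = 2 \<theta>\<^sub>2(2\<tau>) \<theta>\<^sub>3(2\<tau>)\<close>, \<open>\<phi> \<theta>\<^sub>2 = 2 \<phi>(2\<tau>) \<theta>\<^sub>4(2\<tau>)\<close> and
  \<open>\<theta>\<^sub>3 D\<theta>\<^sub>4 - \<theta>\<^sub>4 D\<theta>\<^sub>3 = - 4 \<phi>(2\<tau>)\<^sup>2\<close>.

  A property that passes from \<open>2\<tau>\<close> to \<open>\<tau>\<close> only has to be checked near \<open>\<i>\<infinity>\<close>, where each series is
  governed by its leading term. In this way the theta-constants have no zeros, and \<open>\<phi> / (\<theta>\<^sub>2 \<theta>\<^sub>3 \<theta>\<^sub>4)\<close>,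
  being invariant under doubling, is the constant \<open>1/2\<close> (\<open>jacobi_derivative_formula\<close>). Hence the
  Wronskians evaluate to products of theta-constants:
  \<open>D log (\<theta>\<^sub>3/\<theta>\<^sub>4) = \<theta>\<^sub>2\<^sup>4/4\<close> and \<open>D log (\<theta>\<^sub>2/\<theta>\<^sub>3) = \<theta>\<^sub>4\<^sup>4/4\<close>.

  These give the differences of the first three identities; the common part is \<open>D log \<phi>\<close>. Jacobi's
  identity \<open>\<phi> = q^(1/4) \<Prod>(1 - q^(2n))\<^sup>3\<close>, proved from a finite version, turns it into a Lambert
  series, and summing that series in the other order gives \<open>\<eta>\<close> (\<open>weierstrass_eta_eq\<close>).

  For the last identity one needs one second-order relation. The rotation applied to the harmonic
  polynomial \<open>n\<^sup>4 - 6 n\<^sup>2 m\<^sup>2 + m\<^sup>4\<close> shows that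
  \<open>T = (2 \<theta>\<^sub>4 D\<^sup>2\<theta>\<^sub>4 - 6 (D\<theta>\<^sub>4)\<^sup>2)/\<theta>\<^sub>4\<^sup>2 + \<theta>\<^sub>2\<^sup>4 \<theta>\<^sub>3\<^sup>4/4\<close> satisfies \<open>T(\<tau>) = - 4 T(2\<tau>)\<close>. As \<open>T\<close> decays exponentially
  at \<open>\<i>\<infinity>\<close>, it vanishes (\<open>theta4_second_bracket\<close>), and the derivative of \<open>\<eta>\<close> follows by algebra.
\<close>

section \<open>Moments of theta series\<close>

text \<open>
  The power \<open>q\<^sup>s\<close> of the nome, with the branch fixed by \<open>\<tau>\<close>; fractional \<open>s\<close> occur because of \<open>\<theta>\<^sub>2\<close>.
\<close>

definition nome_pow :: "complex \<Rightarrow> real \<Rightarrow> complex" where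
  "nome_pow \<tau> s = exp (of_real s * of_real pi * \<i> * \<tau>)"

text \<open>
  One family covers all series that occur: \<open>\<theta>\<^sub>2\<close>, \<open>\<theta>\<^sub>3\<close>, \<open>\<theta>\<^sub>4\<close> are the moments with \<open>j = 0\<close> and
  \<open>(\<epsilon>, \<delta>) = (1, 1/2), (1, 0), (-1, 0)\<close>, their derivatives are the moments with \<open>j = 2, 4\<close>, and
  \<open>\<epsilon> = -1\<close>, \<open>\<delta> = 1/2\<close>, \<open>j = 1\<close> gives, up to a constant, the derivative of \<open>\<theta>\<^sub>1\<close> at the origin.
\<close>

definition theta_term :: "complex \<Rightarrow> real \<Rightarrow> nat \<Rightarrow> complex \<Rightarrow> int \<Rightarrow> complex" where
  "theta_term \<epsilon> \<delta> j \<tau> n =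
     \<epsilon> powi n * of_real (of_int n + \<delta>) ^ j * nome_pow \<tau> ((of_int n + \<delta>)\<^sup>2)"

definition theta_moment :: "complex \<Rightarrow> real \<Rightarrow> nat \<Rightarrow> complex \<Rightarrow> complex" where
  "theta_moment \<epsilon> \<delta> j \<tau> = (\<Sum>\<^sub>\<infinity>n. theta_term \<epsilon> \<delta> j \<tau> n)"

lemma nome_pow_add: "nome_pow \<tau> (s + t) = nome_pow \<tau> s * nome_pow \<tau> t"
  by (simp add: nome_pow_def exp_add [symmetric] algebra_simps)

lemma nome_pow_scale: "nome_pow (of_real c * \<tau>) s = nome_pow \<tau> (c * s)"
  by (simp add: nome_pow_def algebra_simps)

lemma norm_nome_pow: "norm (nome_pow \<tau> s) = exp (- (pi * s * Im \<tau>))"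
  by (simp add: nome_pow_def)

lemma nome_pow_nonzero [simp]: "nome_pow \<tau> s \<noteq> 0"
  by (simp add: nome_pow_def)

lemma has_field_derivative_nome_pow:
  "((\<lambda>\<tau>. nome_pow \<tau> s) has_field_derivative \<i> * of_real pi * of_real s * nome_pow \<tau> s) (at \<tau>)"
  unfolding nome_pow_def by (auto intro!: derivative_eq_intros)

lemma summable_exp_neg_abs_int: "(\<lambda>n::int. exp (- \<bar>of_int n\<bar> :: real)) summable_on UNIV"
proof -
  have "summable (\<lambda>k. exp (-1::real) ^ k)"
    by (rule summable_geometric) simp
  then have nat: "(\<lambda>k::nat. exp (- real k)) summable_on UNIV"
    by (subst summable_on_UNIV_nonneg_real_iff) (simp_all add: exp_of_nat_mult [symmetric])
  have "(\<lambda>n::int. exp (- \<bar>of_int n\<bar> :: real)) summable_on range int"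
    by (subst summable_on_reindex) (use nat in \<open>simp_all add: o_def\<close>)
  moreover have "(\<lambda>n::int. exp (- \<bar>of_int n\<bar> :: real)) summable_on range (\<lambda>k. - int k)"
    by (subst summable_on_reindex) (use nat in \<open>simp_all add: o_def inj_on_def\<close>)
  ultimately have "(\<lambda>n::int. exp (- \<bar>of_int n\<bar> :: real)) summable_on (range int \<union> range (\<lambda>k. - int k))"
    by (rule summable_on_union)
  also have "range int \<union> range (\<lambda>k. - int k) = UNIV"
    by (auto simp: image_iff) (metis int_cases2)
  finally show ?thesis .
qed

text \<open>
  A bound that is uniform on \<open>Im \<tau> \<ge> y\<close>, for the Weierstrass M-test. The power is absorbed by
  \<open>\<bar>r\<bar>\<^sup>j \<le> j! exp \<bar>r\<bar>\<close>, and completing the square leaves \<open>exp (- \<bar>r\<bar>)\<close> of the Gaussian.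
\<close>

lemma norm_theta_term_le:
  assumes "norm \<epsilon> = 1" "y > 0" "Im \<tau> \<ge> y"
  shows "norm (theta_term \<epsilon> \<delta> j \<tau> n) \<le> fact j * exp (1 / (pi * y) + \<bar>\<delta>\<bar>) * exp (- \<bar>of_int n\<bar>)"
proof -
  define r where "r = real_of_int n + \<delta>"
  \<comment> \<open>one term of the exponential series\<close>
  have pow: "\<bar>r\<bar> ^ j \<le> fact j * exp \<bar>r\<bar>"
  proof -
    have "(\<Sum>i\<in>{j}. inverse (fact i) * \<bar>r\<bar> ^ i) \<le> (\<Sum>i. inverse (fact i) * \<bar>r\<bar> ^ i)"
      by (rule sum_le_suminf) (use summable_exp [of "\<bar>r\<bar>"] in auto)
    then have "inverse (fact j) * \<bar>r\<bar> ^ j \<le> exp \<bar>r\<bar>"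
      by (simp add: exp_def scaleR_conv_of_real)
    then show ?thesis
      by (simp add: field_simps)
  qed
  have gauss: "\<bar>r\<bar> - pi * r\<^sup>2 * Im \<tau> \<le> 1 / (pi * y) - \<bar>r\<bar>"
  proof -
    have "0 \<le> (pi * y * \<bar>r\<bar> - 1)\<^sup>2 / (pi * y)"
      using assms by simp
    also have "\<dots> = pi * y * r\<^sup>2 - 2 * \<bar>r\<bar> + 1 / (pi * y)"
      using assms by (simp add: power2_diff field_simps power2_eq_square)
    also have "pi * y * r\<^sup>2 \<le> pi * r\<^sup>2 * Im \<tau>"
      using mult_left_mono [OF assms(3), of "pi * r\<^sup>2"] by (simp add: mult_ac)
    finally show ?thesis by simp
  qed
  have "norm (theta_term \<epsilon> \<delta> j \<tau> n) = \<bar>r\<bar> ^ j * exp (- (pi * r\<^sup>2 * Im \<tau>))"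
    unfolding theta_term_def r_def [symmetric]
    using assms(1) by (simp add: norm_mult norm_power_int norm_power norm_nome_pow)
  also have "\<dots> \<le> fact j * exp \<bar>r\<bar> * exp (- (pi * r\<^sup>2 * Im \<tau>))"
    by (intro mult_right_mono pow) auto
  also have "\<dots> = fact j * exp (\<bar>r\<bar> - pi * r\<^sup>2 * Im \<tau>)"
    by (simp flip: exp_add)
  also have "\<dots> \<le> fact j * exp (1 / (pi * y) - \<bar>r\<bar>)"
    using gauss by simp
  also have "\<dots> \<le> fact j * exp (1 / (pi * y) + \<bar>\<delta>\<bar> - \<bar>of_int n\<bar>)"
    by (simp add: r_def)
  finally show ?thesis
    by (simp add: exp_add exp_diff exp_minus field_simps)
qed

lemma summable_exp_bound: "(\<lambda>n::int. C * exp (- \<bar>of_int n\<bar> :: real)) summable_on A"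
  by (intro summable_on_cmult_right summable_on_subset_banach [OF summable_exp_neg_abs_int]) auto

lemma abs_summable_theta_term:
  assumes "norm \<epsilon> = 1" "Im \<tau> > 0"
  shows "(\<lambda>n. norm (theta_term \<epsilon> \<delta> j \<tau> n)) summable_on A"
  by (rule Infinite_Sum.abs_summable_on_comparison_test' [OF summable_exp_bound norm_theta_term_le])
     (use assms in auto)

lemma has_sum_theta_moment:
  assumes "norm \<epsilon> = 1" "Im \<tau> > 0"
  shows "(theta_term \<epsilon> \<delta> j \<tau> has_sum theta_moment \<epsilon> \<delta> j \<tau>) UNIV"
  unfolding theta_moment_def
  using abs_summable_summable [OF abs_summable_theta_term [OF assms]] by (simp add: has_sum_infsum)

text \<open>
  Termwise differentiation: locally uniform limits of holomorphic functions may be differentiated,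
  here along the net of finite partial sums.
\<close>

lemma has_field_derivative_theta_moment:
  assumes "norm \<epsilon> = 1" "Im \<tau> > 0"
  shows "(theta_moment \<epsilon> \<delta> j has_field_derivative \<i> * of_real pi * theta_moment \<epsilon> \<delta> (j + 2) \<tau>) (at \<tau>)"
proof -
  define r where "r = Im \<tau> / 2"
  have r: "r > 0" using assms by (simp add: r_def)
  have im: "Im w \<ge> r" if "w \<in> cball \<tau> r" for w
    using that abs_Im_le_cmod [of "\<tau> - w"] by (simp add: dist_norm r_def)
  have der: "((\<lambda>w. theta_term \<epsilon> \<delta> j w n) has_field_derivative
      \<i> * of_real pi * theta_term \<epsilon> \<delta> (j + 2) w n) (at w)" for n w
    unfolding theta_term_def
    by (auto intro!: derivative_eq_intros has_field_derivative_nome_pow simp: power_add power2_eq_square)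
  have der_sum: "((\<lambda>w. \<Sum>n\<in>X. theta_term \<epsilon> \<delta> j w n) has_field_derivative
      (\<Sum>n\<in>X. \<i> * of_real pi * theta_term \<epsilon> \<delta> (j + 2) w n)) (at w)" for X w
    by (intro DERIV_sum der)
  have unif: "uniform_limit (cball \<tau> r) (\<lambda>X w. \<Sum>n\<in>X. theta_term \<epsilon> \<delta> j w n) (theta_moment \<epsilon> \<delta> j)
     (finite_subsets_at_top UNIV)"
    unfolding theta_moment_def
    by (rule Weierstrass_m_test_general [OF norm_theta_term_le [where y = r] summable_exp_bound])
       (use assms r im in auto)
  obtain g' where g': "\<And>w. w \<in> ball \<tau> r \<Longrightarrow> (theta_moment \<epsilon> \<delta> j has_field_derivative g' w) (at w) \<and>
      ((\<lambda>X. \<Sum>n\<in>X. \<i> * of_real pi * theta_term \<epsilon> \<delta> (j + 2) w n) \<longlongrightarrow> g' w) (finite_subsets_at_top UNIV)"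
  proof (rule has_complex_derivative_uniform_limit [OF _ unif])
    show "\<forall>\<^sub>F X in finite_subsets_at_top UNIV. continuous_on (cball \<tau> r) (\<lambda>w. \<Sum>n\<in>X. theta_term \<epsilon> \<delta> j w n) \<and>
       (\<forall>w\<in>ball \<tau> r. ((\<lambda>w. \<Sum>n\<in>X. theta_term \<epsilon> \<delta> j w n) has_field_derivative
          (\<Sum>n\<in>X. \<i> * of_real pi * theta_term \<epsilon> \<delta> (j + 2) w n)) (at w))"
      by (intro always_eventually allI conjI ballI der_sum DERIV_continuous_on)
         (rule has_field_derivative_at_within [OF der_sum])
  qed (use r in auto)
  have "((\<lambda>n. \<i> * of_real pi * theta_term \<epsilon> \<delta> (j + 2) \<tau> n) has_sum g' \<tau>) UNIV"
    using g' [of \<tau>] r by (simp add: has_sum_def)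
  moreover have "((\<lambda>n. \<i> * of_real pi * theta_term \<epsilon> \<delta> (j + 2) \<tau> n) has_sum
      \<i> * of_real pi * theta_moment \<epsilon> \<delta> (j + 2) \<tau>) UNIV"
    by (intro has_sum_cmult_right has_sum_theta_moment assms)
  ultimately have "g' \<tau> = \<i> * of_real pi * theta_moment \<epsilon> \<delta> (j + 2) \<tau>"
    by (rule has_sum_unique)
  then show ?thesis
    using g' [of \<tau>] r by simp
qed

text \<open>
  The part of the series with exponents at least \<open>\<rho>\<close> is of order \<open>\<bar>q\<bar>\<^sup>\<rho>\<close>: compared with \<open>\<tau> = \<i>\<close> every term
  gains at least the factor \<open>exp (- \<pi> \<rho> (Im \<tau> - 1))\<close>.
\<close>

lemma theta_tail_bound:
  assumes "norm \<epsilon> = 1" and "\<And>n. n \<in> S \<Longrightarrow> (of_int n + \<delta>)\<^sup>2 \<ge> \<rho>"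
  obtains K where "\<And>\<tau>. Im \<tau> \<ge> 1 \<Longrightarrow>
     norm (\<Sum>\<^sub>\<infinity>n\<in>S. theta_term \<epsilon> \<delta> j \<tau> n) \<le> K * exp (- (pi * \<rho> * Im \<tau>))"
proof -
  define M where "M = (\<Sum>\<^sub>\<infinity>n\<in>S. norm (theta_term \<epsilon> \<delta> j \<i> n))"
  have abs: "(\<lambda>n. norm (theta_term \<epsilon> \<delta> j \<tau> n)) summable_on S" if "Im \<tau> > 0" for \<tau>
    using that assms abs_summable_theta_term by blast
  have "norm (\<Sum>\<^sub>\<infinity>n\<in>S. theta_term \<epsilon> \<delta> j \<tau> n) \<le> (M * exp (pi * \<rho>)) * exp (- (pi * \<rho> * Im \<tau>))"
    if "Im \<tau> \<ge> 1" for \<tau>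
  proof -
    have le: "norm (theta_term \<epsilon> \<delta> j \<tau> n) \<le> norm (theta_term \<epsilon> \<delta> j \<i> n) * exp (- (pi * \<rho> * (Im \<tau> - 1)))"
      if "n \<in> S" for n
    proof -
      have "\<rho> * (Im \<tau> - 1) \<le> (of_int n + \<delta>)\<^sup>2 * (Im \<tau> - 1)"
        using assms(2) [OF that] \<open>Im \<tau> \<ge> 1\<close> by (intro mult_right_mono) auto
      then have "pi * (\<rho> * (Im \<tau> - 1)) \<le> pi * ((of_int n + \<delta>)\<^sup>2 * (Im \<tau> - 1))"
        by (intro mult_left_mono) auto
      then have "exp (- (pi * (of_int n + \<delta>)\<^sup>2 * Im \<tau>)) \<le>
          exp (- (pi * (of_int n + \<delta>)\<^sup>2)) * exp (- (pi * \<rho> * (Im \<tau> - 1)))"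
        by (simp add: algebra_simps flip: exp_add)
      then show ?thesis
        by (simp add: theta_term_def norm_mult norm_nome_pow mult.assoc mult_left_mono)
    qed
    have "norm (\<Sum>\<^sub>\<infinity>n\<in>S. theta_term \<epsilon> \<delta> j \<tau> n) \<le> (\<Sum>\<^sub>\<infinity>n\<in>S. norm (theta_term \<epsilon> \<delta> j \<tau> n))"
      using abs [of \<tau>] that by (intro norm_infsum_bound) auto
    also have "\<dots> \<le> (\<Sum>\<^sub>\<infinity>n\<in>S. norm (theta_term \<epsilon> \<delta> j \<i> n) * exp (- (pi * \<rho> * (Im \<tau> - 1))))"
      using abs that by (intro infsum_mono summable_on_cmult_left le) auto
    also have "\<dots> = M * exp (- (pi * \<rho> * (Im \<tau> - 1)))"
      unfolding M_def by (rule infsum_cmult_left) (use abs in auto)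
    finally show ?thesis
      by (simp add: algebra_simps flip: exp_add)
  qed
  then show thesis by (rule that)
qed

section \<open>Rotating the lattice of summation\<close>

lemma abs_summable_times_product:
  fixes f :: "'a \<Rightarrow> 'c :: {real_normed_field, banach}" and g :: "'b \<Rightarrow> 'c"
  assumes "(\<lambda>n. norm (f n)) summable_on UNIV" "(\<lambda>n. norm (g n)) summable_on UNIV"
  shows "(\<lambda>x. norm (f (fst x) * g (snd x))) summable_on UNIV"
proof -
  have "(\<lambda>x. norm (f (fst x) * g (snd x))) summable_on Sigma UNIV (\<lambda>_. UNIV)"
    unfolding Infinite_Sum.abs_summable_on_Sigma_iff
    using assms summable_on_cmult_left [OF assms(1), of "\<bar>\<Sum>\<^sub>\<infinity>y. norm (g y)\<bar>"]
    by (auto simp: norm_mult infsum_cmult_right' abs_mult intro!: summable_on_cmult_right)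
  then show ?thesis by simp
qed

lemma has_sum_times_product:
  fixes f :: "'a \<Rightarrow> 'c :: {real_normed_field, banach}" and g :: "'b \<Rightarrow> 'c"
  assumes "(\<lambda>n. norm (f n)) summable_on UNIV" "(\<lambda>n. norm (g n)) summable_on UNIV"
    and "(f has_sum X) UNIV" "(g has_sum Y) UNIV"
  shows "((\<lambda>x. f (fst x) * g (snd x)) has_sum X * Y) UNIV"
proof -
  have "(\<lambda>x. f (fst x) * g (snd x)) summable_on Sigma UNIV (\<lambda>_. UNIV)"
    using abs_summable_summable [OF abs_summable_times_product [OF assms(1,2)]] by simp
  moreover have "((\<lambda>a. f a * Y) has_sum X * Y) UNIV"
    by (intro has_sum_cmult_left assms)
  ultimately have "((\<lambda>x. f (fst x) * g (snd x)) has_sum X * Y) (Sigma UNIV (\<lambda>_. UNIV))"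
    by (intro has_sum_SigmaI [where g = "\<lambda>a. f a * Y"]) (auto intro!: has_sum_cmult_right assms)
  then show ?thesis by simp
qed

text \<open>
  The sublattice \<open>n \<equiv> m (mod 2)\<close> is the image of \<open>\<int>\<^sup>2\<close> under \<open>(a, b) \<mapsto> (a + b, a - b)\<close>, and its other coset
  is the same image moved by \<open>(1, 0)\<close>. Over the moved coset it is best to think of \<open>a + 1/2\<close> and
  \<open>b + 1/2\<close> as the summation variables.
\<close>

lemma has_sum_lattice_rotation:
  fixes h :: "int \<times> int \<Rightarrow> complex"
  assumes "(h has_sum Z) UNIV"
    and "(u has_sum X) UNIV" "\<And>a b. h (a + b, a - b) = u (a, b)"
    and "(v has_sum Y) UNIV" "\<And>a b. h (a + b + 1, a - b) = v (a, b)"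
  shows "Z = X + Y"
proof -
  have even: "range (\<lambda>(a, b). (a + b, a - b)) = {(n, m :: int). even (n - m)}"
  proof safe
    fix n m :: int
    assume "even (n - m)"
    then obtain c where "n - m = 2 * c" ..
    then have "(n, m) = (\<lambda>(a, b). (a + b, a - b)) (m + c, c)" by simp
    then show "(n, m) \<in> range (\<lambda>(a, b). (a + b, a - b))" by blast
  qed auto
  have odd: "range (\<lambda>(a, b). (a + b + 1, a - b)) = {(n, m :: int). odd (n - m)}"
  proof safe
    fix n m :: int
    assume "odd (n - m)"
    then obtain c where "n - m = 2 * c + 1" ..
    then have "(n, m) = (\<lambda>(a, b). (a + b + 1, a - b)) (m + c, c)" by simp
    then show "(n, m) \<in> range (\<lambda>(a, b). (a + b + 1, a - b))" by blast
  qed auto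
  have "(h has_sum X) {(n, m). even (n - m)}"
    unfolding even [symmetric]
    by (subst has_sum_reindex) (use assms(2,3) in \<open>auto simp: inj_on_def o_def case_prod_unfold\<close>)
  moreover have "(h has_sum Y) {(n, m). odd (n - m)}"
    unfolding odd [symmetric]
    by (subst has_sum_reindex) (use assms(4,5) in \<open>auto simp: inj_on_def o_def case_prod_unfold\<close>)
  ultimately have "(h has_sum X + Y) ({(n, m). even (n - m)} \<union> {(n, m). odd (n - m)})"
    by (intro has_sum_Un_disjoint) auto
  also have "{(n, m). even (n - m)} \<union> {(n, m). odd (n - m)} = (UNIV :: (int \<times> int) set)"
    by auto
  finally show ?thesis
    using assms(1) has_sum_unique by blast
qed

lemma has_sum_theta_product:
  assumes "Im \<tau> > 0" "norm \<epsilon> = 1" "norm \<epsilon>' = 1"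
  shows "((\<lambda>x. theta_term \<epsilon> \<delta> j \<tau> (fst x) * theta_term \<epsilon>' \<delta>' k \<tau> (snd x)) has_sum
      theta_moment \<epsilon> \<delta> j \<tau> * theta_moment \<epsilon>' \<delta>' k \<tau>) UNIV"
  by (intro has_sum_times_product abs_summable_theta_term has_sum_theta_moment assms)

text \<open>
  The reflection \<open>n \<mapsto> - n - 2\<delta>\<close> changes the sign of \<open>n + \<delta>\<close>. It makes the moments of the wrong parity
  vanish, which is what removes the unwanted terms from the doubling formulas.
\<close>

lemma theta_moment_reflect:
  assumes "\<And>n. \<epsilon> powi (- n - c) = s * \<epsilon> powi n" "2 * \<delta> = of_int c"
  shows "theta_moment \<epsilon> \<delta> j \<tau> = s * (-1) ^ j * theta_moment \<epsilon> \<delta> j \<tau>"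
proof -
  have "theta_moment \<epsilon> \<delta> j \<tau> = (\<Sum>\<^sub>\<infinity>n. theta_term \<epsilon> \<delta> j \<tau> (- n - c))"
    unfolding theta_moment_def
    by (rule infsum_reindex_bij_witness [where i = "\<lambda>n. - n - c" and j = "\<lambda>n. - n - c"]) auto
  also have "theta_term \<epsilon> \<delta> j \<tau> (- n - c) = s * (-1) ^ j * theta_term \<epsilon> \<delta> j \<tau> n" for n
  proof -
    have r: "of_int (- n - c) + \<delta> = - (of_int n + \<delta>)"
      using assms(2) by simp
    have "of_real (of_int (- n - c) + \<delta>) ^ j = ((-1) ^ j * of_real (of_int n + \<delta>) ^ j :: complex)"
      unfolding r by (simp only: of_real_minus) (rule power_minus)
    moreover have "(of_int (- n - c) + \<delta>)\<^sup>2 = (of_int n + \<delta>)\<^sup>2"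
      unfolding r by (rule power2_minus)
    ultimately show ?thesis
      unfolding theta_term_def assms(1) by simp
  qed
  then have "(\<Sum>\<^sub>\<infinity>n. theta_term \<epsilon> \<delta> j \<tau> (- n - c)) = (\<Sum>\<^sub>\<infinity>n. s * (-1) ^ j * theta_term \<epsilon> \<delta> j \<tau> n)"
    by presburger
  also have "\<dots> = s * (-1) ^ j * theta_moment \<epsilon> \<delta> j \<tau>"
    unfolding theta_moment_def by (rule infsum_cmult_right')
  finally show ?thesis .
qed

lemma theta_moment_alternating_odd:
  assumes "odd j" shows "theta_moment (-1) 0 j \<tau> = 0"
  using theta_moment_reflect [of "-1" 0 1 0 j \<tau>] assms
  by (simp add: power_int_minus flip: power_int_inverse)

lemma theta_moment_half_alternating_even:
  assumes "even j" shows "theta_moment (-1) (1/2) j \<tau> = 0"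
  using theta_moment_reflect [of "-1" 1 "-1" "1/2" j \<tau>] assms
  by (simp add: power_int_minus_one_minus power_int_diff)

text \<open>
  The parallelogram law \<open>(\<alpha> + \<beta>)\<^sup>2 + (\<alpha> - \<beta>)\<^sup>2 = 2 \<alpha>\<^sup>2 + 2 \<beta>\<^sup>2\<close> is the source of all doubling formulas.
\<close>

lemma theta_term_mult_rotate:
  assumes "of_int n + \<delta> = \<alpha> + \<beta>" "of_int m + \<delta>' = \<alpha> - \<beta>"
  shows "theta_term \<epsilon> \<delta> j \<tau> n * theta_term \<epsilon>' \<delta>' k \<tau> m =
     \<epsilon> powi n * \<epsilon>' powi m * (of_real \<alpha> + of_real \<beta>) ^ j * (of_real \<alpha> - of_real \<beta>) ^ k *
       (nome_pow (2 * \<tau>) (\<alpha>\<^sup>2) * nome_pow (2 * \<tau>) (\<beta>\<^sup>2))"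
proof -
  have "nome_pow \<tau> ((\<alpha> + \<beta>)\<^sup>2) * nome_pow \<tau> ((\<alpha> - \<beta>)\<^sup>2) = nome_pow \<tau> (2 * \<alpha>\<^sup>2) * nome_pow \<tau> (2 * \<beta>\<^sup>2)"
    unfolding nome_pow_add [symmetric] by (simp add: power2_eq_square algebra_simps)
  also have "\<dots> = nome_pow (2 * \<tau>) (\<alpha>\<^sup>2) * nome_pow (2 * \<tau>) (\<beta>\<^sup>2)"
    using nome_pow_scale [of 2 \<tau>] by simp
  finally show ?thesis
    unfolding theta_term_def assms by (simp add: mult_ac)
qed

lemma theta_term_mult:
  "theta_term \<epsilon> \<delta> j \<tau> a * theta_term \<epsilon>' \<delta>' k \<tau> b =
     \<epsilon> powi a * \<epsilon>' powi b * (of_int a + of_real \<delta>) ^ j * (of_int b + of_real \<delta>') ^ k *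
       (nome_pow \<tau> ((of_int a + \<delta>)\<^sup>2) * nome_pow \<tau> ((of_int b + \<delta>')\<^sup>2))"
  unfolding theta_term_def by simp

lemma power_int_minus_one_diff: "(-1 :: complex) powi (a - b) = (-1) powi a * (-1) powi b"
  by (simp add: power_int_diff divide_inverse flip: power_int_inverse)

lemma power_int_minus_one_mult_self': "(-1 :: complex) powi a * ((-1) powi a * z) = z"
  by (simp add: power_int_minus_one_mult_self flip: mult.assoc)

lemmas sign_simps = power_int_add power_int_minus_one_diff power_int_minus_one_mult_self

lemmas theta_product_intros = has_sum_theta_product has_sum_add has_sum_cmult_right

text \<open>
  Rotating a product of series with \<open>\<delta> = 1/2\<close> produces moments with \<open>\<delta> = 1\<close> on the odd coset; the
  shift leads them back to \<open>\<delta> = 0\<close>.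
\<close>

lemma theta_moment_shift:
  assumes "\<epsilon> \<noteq> 0"
  shows "theta_moment \<epsilon> (\<delta> + 1) j \<tau> = inverse \<epsilon> * theta_moment \<epsilon> \<delta> j \<tau>"
proof -
  have "theta_moment \<epsilon> \<delta> j \<tau> = (\<Sum>\<^sub>\<infinity>n. theta_term \<epsilon> \<delta> j \<tau> (n + 1))"
    unfolding theta_moment_def
    by (rule infsum_reindex_bij_witness [where i = "\<lambda>n. n + 1" and j = "\<lambda>n. n - 1"]) auto
  also have "\<dots> = (\<Sum>\<^sub>\<infinity>n. \<epsilon> * theta_term \<epsilon> (\<delta> + 1) j \<tau> n)"
    using assms by (intro infsum_cong) (simp add: theta_term_def power_int_add add_ac)
  also have "\<dots> = \<epsilon> * theta_moment \<epsilon> (\<delta> + 1) j \<tau>"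
    unfolding theta_moment_def by (rule infsum_cmult_right')
  finally show ?thesis
    using assms by simp
qed

lemma theta_moment_one_eq: "theta_moment 1 1 j \<tau> = theta_moment 1 0 j \<tau>"
  using theta_moment_shift [of 1 0 j \<tau>] by simp

lemma theta_moment_alternating_one_eq: "theta_moment (-1) 1 j \<tau> = - theta_moment (-1) 0 j \<tau>"
  using theta_moment_shift [of "-1" 0 j \<tau>] by simp

section \<open>Doubling formulas\<close>

text \<open>
  On the odd coset both factors are \<open>\<Sum> (-1)\<^sup>a q^(2 (a + 1/2)\<^sup>2)\<close>, which vanishes by reflection.
\<close>

lemma theta3_theta4_doubling:
  assumes "Im \<tau> > 0"
  shows "theta_moment 1 0 0 \<tau> * theta_moment (-1) 0 0 \<tau> = (theta_moment (-1) 0 0 (2 * \<tau>))\<^sup>2"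
proof -
  have "theta_moment 1 0 0 \<tau> * theta_moment (-1) 0 0 \<tau> =
     theta_moment (-1) 0 0 (2 * \<tau>) * theta_moment (-1) 0 0 (2 * \<tau>) +
     theta_moment (-1) (1/2) 0 (2 * \<tau>) * theta_moment (-1) (1/2) 0 (2 * \<tau>)"
  proof (rule has_sum_lattice_rotation [OF has_sum_theta_product has_sum_theta_product _ has_sum_theta_product])
    fix a b :: int
    show "theta_term 1 0 0 \<tau> (fst (a + b, a - b)) * theta_term (- 1) 0 0 \<tau> (snd (a + b, a - b)) =
       theta_term (- 1) 0 0 (2 * \<tau>) (fst (a, b)) * theta_term (- 1) 0 0 (2 * \<tau>) (snd (a, b))"
      by (simp add: theta_term_mult_rotate [of _ _ "of_int a" "of_int b"] theta_term_mult [where \<tau> = "2 * \<tau>"] sign_simps)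
    show "theta_term 1 0 0 \<tau> (fst (a + b + 1, a - b)) * theta_term (- 1) 0 0 \<tau> (snd (a + b + 1, a - b)) =
       theta_term (- 1) (1/2) 0 (2 * \<tau>) (fst (a, b)) * theta_term (- 1) (1/2) 0 (2 * \<tau>) (snd (a, b))"
      by (simp add: theta_term_mult_rotate [of _ _ "of_int a + 1/2" "of_int b + 1/2"] theta_term_mult [where \<tau> = "2 * \<tau>"] sign_simps)
  qed (use assms in auto)
  then show ?thesis
    by (simp add: theta_moment_half_alternating_even power2_eq_square)
qed

lemma theta2_doubling:
  assumes "Im \<tau> > 0"
  shows "(theta_moment 1 (1/2) 0 \<tau>)\<^sup>2 = 2 * theta_moment 1 (1/2) 0 (2 * \<tau>) * theta_moment 1 0 0 (2 * \<tau>)"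
proof -
  have "theta_moment 1 (1/2) 0 \<tau> * theta_moment 1 (1/2) 0 \<tau> =
     theta_moment 1 (1/2) 0 (2 * \<tau>) * theta_moment 1 0 0 (2 * \<tau>) +
     theta_moment 1 1 0 (2 * \<tau>) * theta_moment 1 (1/2) 0 (2 * \<tau>)"
  proof (rule has_sum_lattice_rotation [OF has_sum_theta_product has_sum_theta_product _ has_sum_theta_product])
    fix a b :: int
    show "theta_term 1 (1/2) 0 \<tau> (fst (a + b, a - b)) * theta_term 1 (1/2) 0 \<tau> (snd (a + b, a - b)) =
       theta_term 1 (1/2) 0 (2 * \<tau>) (fst (a, b)) * theta_term 1 0 0 (2 * \<tau>) (snd (a, b))"
      by (simp add: theta_term_mult_rotate [of _ _ "of_int a + 1/2" "of_int b"] theta_term_mult [where \<tau> = "2 * \<tau>"] sign_simps)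
    show "theta_term 1 (1/2) 0 \<tau> (fst (a + b + 1, a - b)) * theta_term 1 (1/2) 0 \<tau> (snd (a + b + 1, a - b)) =
       theta_term 1 1 0 (2 * \<tau>) (fst (a, b)) * theta_term 1 (1/2) 0 (2 * \<tau>) (snd (a, b))"
      by (simp add: theta_term_mult_rotate [of _ _ "of_int a + 1" "of_int b + 1/2"] theta_term_mult [where \<tau> = "2 * \<tau>"] sign_simps)
  qed (use assms in auto)
  then show ?thesis
    by (simp add: theta_moment_one_eq power2_eq_square)
qed

text \<open>
  The weight \<open>\<alpha> + \<beta>\<close> gives two products on each coset. One of them has a factor that vanishes by
  reflection; the others agree, whence the factor 2.
\<close>

lemma theta1'_theta2_doubling:
  assumes "Im \<tau> > 0"
  shows "theta_moment (-1) (1/2) 1 \<tau> * theta_moment 1 (1/2) 0 \<tau> =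
     2 * theta_moment (-1) (1/2) 1 (2 * \<tau>) * theta_moment (-1) 0 0 (2 * \<tau>)"
proof -
  have "theta_moment (-1) (1/2) 1 \<tau> * theta_moment 1 (1/2) 0 \<tau> =
     (theta_moment (-1) (1/2) 1 (2 * \<tau>) * theta_moment (-1) 0 0 (2 * \<tau>) +
      theta_moment (-1) (1/2) 0 (2 * \<tau>) * theta_moment (-1) 0 1 (2 * \<tau>)) +
     ((-1) * (theta_moment (-1) 1 1 (2 * \<tau>) * theta_moment (-1) (1/2) 0 (2 * \<tau>)) +
      (-1) * (theta_moment (-1) 1 0 (2 * \<tau>) * theta_moment (-1) (1/2) 1 (2 * \<tau>)))"
  proof (rule has_sum_lattice_rotation [OF has_sum_theta_product])
    fix a b :: int
    show "theta_term (-1) (1/2) 1 \<tau> (fst (a + b, a - b)) * theta_term 1 (1/2) 0 \<tau> (snd (a + b, a - b)) =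
       (\<lambda>x. theta_term (-1) (1/2) 1 (2 * \<tau>) (fst x) * theta_term (-1) 0 0 (2 * \<tau>) (snd x) +
        theta_term (-1) (1/2) 0 (2 * \<tau>) (fst x) * theta_term (-1) 0 1 (2 * \<tau>) (snd x)) (a, b)"
      by (simp add: theta_term_mult_rotate [of _ _ "of_int a + 1/2" "of_int b"] theta_term_mult [where \<tau> = "2 * \<tau>"] sign_simps,
          simp add: algebra_simps)
    show "theta_term (-1) (1/2) 1 \<tau> (fst (a + b + 1, a - b)) * theta_term 1 (1/2) 0 \<tau> (snd (a + b + 1, a - b)) =
       (\<lambda>x. (-1) * (theta_term (-1) 1 1 (2 * \<tau>) (fst x) * theta_term (-1) (1/2) 0 (2 * \<tau>) (snd x)) +
        (-1) * (theta_term (-1) 1 0 (2 * \<tau>) (fst x) * theta_term (-1) (1/2) 1 (2 * \<tau>) (snd x))) (a, b)"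
      by (simp add: theta_term_mult_rotate [of _ _ "of_int a + 1" "of_int b + 1/2"] theta_term_mult [where \<tau> = "2 * \<tau>"] sign_simps,
          simp add: algebra_simps)
  qed ((intro theta_product_intros)?; simp add: assms)+
  then show ?thesis
    by (simp add: theta_moment_half_alternating_even theta_moment_alternating_one_eq)
qed

text \<open>
  For \<open>n = \<alpha> + \<beta>\<close> and \<open>m = \<alpha> - \<beta>\<close> the factor \<open>m\<^sup>2 - n\<^sup>2 = - 4 \<alpha> \<beta>\<close> separates the variables. On the even sublattice both factors are odd
  moments of \<open>\<theta>\<^sub>4\<close> and vanish, so only the square from the odd coset remains.
\<close>

lemma theta3_theta4_wronskian:
  assumes "Im \<tau> > 0"
  shows "theta_moment 1 0 0 \<tau> * theta_moment (-1) 0 2 \<tau> - theta_moment 1 0 2 \<tau> * theta_moment (-1) 0 0 \<tau> =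
     - 4 * (theta_moment (-1) (1/2) 1 (2 * \<tau>))\<^sup>2"
proof -
  have "theta_moment 1 0 0 \<tau> * theta_moment (-1) 0 2 \<tau> + (-1) * (theta_moment 1 0 2 \<tau> * theta_moment (-1) 0 0 \<tau>) =
     (-4) * (theta_moment (-1) 0 1 (2 * \<tau>) * theta_moment (-1) 0 1 (2 * \<tau>)) +
     (-4) * (theta_moment (-1) (1/2) 1 (2 * \<tau>) * theta_moment (-1) (1/2) 1 (2 * \<tau>))"
  proof (rule has_sum_lattice_rotation)
    show "((\<lambda>x. theta_term 1 0 0 \<tau> (fst x) * theta_term (-1) 0 2 \<tau> (snd x) +
        (-1) * (theta_term 1 0 2 \<tau> (fst x) * theta_term (-1) 0 0 \<tau> (snd x))) has_sum
      (theta_moment 1 0 0 \<tau> * theta_moment (-1) 0 2 \<tau> +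
        (-1) * (theta_moment 1 0 2 \<tau> * theta_moment (-1) 0 0 \<tau>))) UNIV"
      by (intro theta_product_intros) (use assms in auto)
    fix a b :: int
    show "theta_term 1 0 0 \<tau> (fst (a + b, a - b)) * theta_term (-1) 0 2 \<tau> (snd (a + b, a - b)) +
        (-1) * (theta_term 1 0 2 \<tau> (fst (a + b, a - b)) * theta_term (-1) 0 0 \<tau> (snd (a + b, a - b))) =
       (\<lambda>x. (-4) * (theta_term (-1) 0 1 (2 * \<tau>) (fst x) * theta_term (-1) 0 1 (2 * \<tau>) (snd x))) (a, b)"
      by (simp add: theta_term_mult_rotate [of _ _ "of_int a" "of_int b"] theta_term_mult [where \<tau> = "2 * \<tau>"] sign_simps,
          simp add: algebra_simps power2_eq_square)
    show "theta_term 1 0 0 \<tau> (fst (a + b + 1, a - b)) * theta_term (-1) 0 2 \<tau> (snd (a + b + 1, a - b)) +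
        (-1) * (theta_term 1 0 2 \<tau> (fst (a + b + 1, a - b)) * theta_term (-1) 0 0 \<tau> (snd (a + b + 1, a - b))) =
       (\<lambda>x. (-4) * (theta_term (-1) (1/2) 1 (2 * \<tau>) (fst x) * theta_term (-1) (1/2) 1 (2 * \<tau>) (snd x))) (a, b)"
      by (simp add: theta_term_mult_rotate [of _ _ "of_int a + 1/2" "of_int b + 1/2"] theta_term_mult [where \<tau> = "2 * \<tau>"] sign_simps,
          simp add: algebra_simps power2_eq_square)
  qed ((intro theta_product_intros)?; simp add: assms)+
  then show ?thesis
    by (simp add: theta_moment_alternating_odd power2_eq_square)
qed

text \<open>
  The weight \<open>(\<alpha> + \<beta>) (\<alpha> - \<beta>) = \<alpha>\<^sup>2 - \<beta>\<^sup>2\<close> turns the square at \<open>\<tau>\<close> into a Wronskian of \<open>\<theta>\<^sub>2\<close> and \<open>\<theta>\<^sub>3\<close> at \<open>2\<tau>\<close>;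
  both cosets contribute it once.
\<close>

lemma theta1'_square:
  assumes "Im \<tau> > 0"
  shows "(theta_moment (-1) (1/2) 1 \<tau>)\<^sup>2 =
    2 * (theta_moment 1 (1/2) 2 (2 * \<tau>) * theta_moment 1 0 0 (2 * \<tau>) -
         theta_moment 1 (1/2) 0 (2 * \<tau>) * theta_moment 1 0 2 (2 * \<tau>))"
proof -
  have "theta_moment (-1) (1/2) 1 \<tau> * theta_moment (-1) (1/2) 1 \<tau> =
     (theta_moment 1 (1/2) 2 (2 * \<tau>) * theta_moment 1 0 0 (2 * \<tau>) +
      (-1) * (theta_moment 1 (1/2) 0 (2 * \<tau>) * theta_moment 1 0 2 (2 * \<tau>))) +
     ((-1) * (theta_moment 1 1 2 (2 * \<tau>) * theta_moment 1 (1/2) 0 (2 * \<tau>)) +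
      theta_moment 1 1 0 (2 * \<tau>) * theta_moment 1 (1/2) 2 (2 * \<tau>))"
  proof (rule has_sum_lattice_rotation [OF has_sum_theta_product])
    fix a b :: int
    show "theta_term (-1) (1/2) 1 \<tau> (fst (a + b, a - b)) * theta_term (-1) (1/2) 1 \<tau> (snd (a + b, a - b)) =
       (\<lambda>x. theta_term 1 (1/2) 2 (2 * \<tau>) (fst x) * theta_term 1 0 0 (2 * \<tau>) (snd x) +
        (-1) * (theta_term 1 (1/2) 0 (2 * \<tau>) (fst x) * theta_term 1 0 2 (2 * \<tau>) (snd x))) (a, b)"
      by (simp add: theta_term_mult_rotate [of _ _ "of_int a + 1/2" "of_int b"] theta_term_mult [where \<tau> = "2 * \<tau>"] sign_simps,
          simp add: algebra_simps power2_eq_square)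
    show "theta_term (-1) (1/2) 1 \<tau> (fst (a + b + 1, a - b)) * theta_term (-1) (1/2) 1 \<tau> (snd (a + b + 1, a - b)) =
       (\<lambda>x. (-1) * (theta_term 1 1 2 (2 * \<tau>) (fst x) * theta_term 1 (1/2) 0 (2 * \<tau>) (snd x)) +
        theta_term 1 1 0 (2 * \<tau>) (fst x) * theta_term 1 (1/2) 2 (2 * \<tau>) (snd x)) (a, b)"
      by (simp add: theta_term_mult_rotate [of _ _ "of_int a + 1" "of_int b + 1/2"] theta_term_mult [where \<tau> = "2 * \<tau>"] sign_simps,
          simp add: algebra_simps power2_eq_square)
  qed ((intro theta_product_intros)?; simp add: assms)+
  then show ?thesis
    by (simp add: theta_moment_one_eq power2_eq_square)
qed

text \<open>
  The polynomial \<open>n\<^sup>4 - 6 n\<^sup>2 m\<^sup>2 + m\<^sup>4\<close> is the real part of \<open>(n + \<i> m)\<^sup>4\<close>. Rotating by an eighth of a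
  turn and scaling by \<open>\<surd>2\<close> multiplies it by \<open>- 4\<close>, so it reproduces itself at \<open>2\<tau>\<close>; the sign
  \<open>(-1)\<^sup>m\<close> becomes \<open>(-1)^(a + b)\<close>. On the odd coset the polynomial is even in \<open>a + 1/2\<close> while \<open>(-1)\<^sup>a\<close> is odd
  under the reflection \<open>a \<mapsto> - 1 - a\<close>, so nothing remains.
\<close>

lemma theta3_theta4_second_bracket:
  assumes "Im \<tau> > 0"
  shows "theta_moment 1 0 4 \<tau> * theta_moment (-1) 0 0 \<tau> + theta_moment 1 0 0 \<tau> * theta_moment (-1) 0 4 \<tau> -
       6 * theta_moment 1 0 2 \<tau> * theta_moment (-1) 0 2 \<tau> =
     - 4 * (2 * theta_moment (-1) 0 4 (2 * \<tau>) * theta_moment (-1) 0 0 (2 * \<tau>) -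
            6 * (theta_moment (-1) 0 2 (2 * \<tau>))\<^sup>2)"
proof -
  have "theta_moment 1 0 4 \<tau> * theta_moment (-1) 0 0 \<tau> + theta_moment 1 0 0 \<tau> * theta_moment (-1) 0 4 \<tau> +
       (-6) * (theta_moment 1 0 2 \<tau> * theta_moment (-1) 0 2 \<tau>) =
     ((-4) * (theta_moment (-1) 0 4 (2 * \<tau>) * theta_moment (-1) 0 0 (2 * \<tau>)) +
      (-4) * (theta_moment (-1) 0 0 (2 * \<tau>) * theta_moment (-1) 0 4 (2 * \<tau>)) +
      24 * (theta_moment (-1) 0 2 (2 * \<tau>) * theta_moment (-1) 0 2 (2 * \<tau>))) +
     ((-4) * (theta_moment (-1) (1/2) 4 (2 * \<tau>) * theta_moment (-1) (1/2) 0 (2 * \<tau>)) +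
      (-4) * (theta_moment (-1) (1/2) 0 (2 * \<tau>) * theta_moment (-1) (1/2) 4 (2 * \<tau>)) +
      24 * (theta_moment (-1) (1/2) 2 (2 * \<tau>) * theta_moment (-1) (1/2) 2 (2 * \<tau>)))"
    (is "?Z = ?X + ?Y")
  proof (rule has_sum_lattice_rotation)
    define h where "h = (\<lambda>x. theta_term 1 0 4 \<tau> (fst x) * theta_term (-1) 0 0 \<tau> (snd x) +
       theta_term 1 0 0 \<tau> (fst x) * theta_term (-1) 0 4 \<tau> (snd x) +
       (-6) * (theta_term 1 0 2 \<tau> (fst x) * theta_term (-1) 0 2 \<tau> (snd x)))"
    show "(h has_sum ?Z) UNIV"
      unfolding h_def by (intro theta_product_intros) (use assms in auto)
    fix a b :: int
    show "h (a + b, a - b) =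
       (\<lambda>x. (-4) * (theta_term (-1) 0 4 (2 * \<tau>) (fst x) * theta_term (-1) 0 0 (2 * \<tau>) (snd x)) +
        (-4) * (theta_term (-1) 0 0 (2 * \<tau>) (fst x) * theta_term (-1) 0 4 (2 * \<tau>) (snd x)) +
        24 * (theta_term (-1) 0 2 (2 * \<tau>) (fst x) * theta_term (-1) 0 2 (2 * \<tau>) (snd x))) (a, b)"
      by (simp add: h_def theta_term_mult_rotate [of _ _ "of_int a" "of_int b"] theta_term_mult [where \<tau> = "2 * \<tau>"] sign_simps,
          simp add: field_simps power2_eq_square power4_eq_xxxx)
    show "h (a + b + 1, a - b) =
       (\<lambda>x. (-4) * (theta_term (-1) (1/2) 4 (2 * \<tau>) (fst x) * theta_term (-1) (1/2) 0 (2 * \<tau>) (snd x)) +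
        (-4) * (theta_term (-1) (1/2) 0 (2 * \<tau>) (fst x) * theta_term (-1) (1/2) 4 (2 * \<tau>) (snd x)) +
        24 * (theta_term (-1) (1/2) 2 (2 * \<tau>) (fst x) * theta_term (-1) (1/2) 2 (2 * \<tau>) (snd x))) (a, b)"
      by (simp add: h_def theta_term_mult_rotate [of _ _ "of_int a + 1/2" "of_int b + 1/2"] theta_term_mult [where \<tau> = "2 * \<tau>"] sign_simps,
          simp add: field_simps power2_eq_square power4_eq_xxxx)
  qed ((intro theta_product_intros)?; simp add: assms)+
  then show ?thesis
    by (simp add: theta_moment_half_alternating_even power2_eq_square mult_ac)
qed

lemma theta3_square_doubling:
  assumes "Im \<tau> > 0"
  shows "(theta_moment 1 0 0 \<tau>)\<^sup>2 = (theta_moment 1 0 0 (2 * \<tau>))\<^sup>2 + (theta_moment 1 (1/2) 0 (2 * \<tau>))\<^sup>2"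
proof -
  have "theta_moment 1 0 0 \<tau> * theta_moment 1 0 0 \<tau> =
     theta_moment 1 0 0 (2 * \<tau>) * theta_moment 1 0 0 (2 * \<tau>) +
     theta_moment 1 (1/2) 0 (2 * \<tau>) * theta_moment 1 (1/2) 0 (2 * \<tau>)"
  proof (rule has_sum_lattice_rotation [OF has_sum_theta_product has_sum_theta_product _ has_sum_theta_product])
    fix a b :: int
    show "theta_term 1 0 0 \<tau> (fst (a + b, a - b)) * theta_term 1 0 0 \<tau> (snd (a + b, a - b)) =
       theta_term 1 0 0 (2 * \<tau>) (fst (a, b)) * theta_term 1 0 0 (2 * \<tau>) (snd (a, b))"
      by (simp add: theta_term_mult_rotate [of _ _ "of_int a" "of_int b"] theta_term_mult [where \<tau> = "2 * \<tau>"] sign_simps)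
    show "theta_term 1 0 0 \<tau> (fst (a + b + 1, a - b)) * theta_term 1 0 0 \<tau> (snd (a + b + 1, a - b)) =
       theta_term 1 (1/2) 0 (2 * \<tau>) (fst (a, b)) * theta_term 1 (1/2) 0 (2 * \<tau>) (snd (a, b))"
      by (simp add: theta_term_mult_rotate [of _ _ "of_int a + 1/2" "of_int b + 1/2"] theta_term_mult [where \<tau> = "2 * \<tau>"] sign_simps)
  qed (use assms in auto)
  then show ?thesis
    by (simp add: power2_eq_square)
qed

lemma theta4_square_doubling:
  assumes "Im \<tau> > 0"
  shows "(theta_moment (-1) 0 0 \<tau>)\<^sup>2 = (theta_moment 1 0 0 (2 * \<tau>))\<^sup>2 - (theta_moment 1 (1/2) 0 (2 * \<tau>))\<^sup>2"
proof -
  have "theta_moment (-1) 0 0 \<tau> * theta_moment (-1) 0 0 \<tau> =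
     theta_moment 1 0 0 (2 * \<tau>) * theta_moment 1 0 0 (2 * \<tau>) +
     (-1) * (theta_moment 1 (1/2) 0 (2 * \<tau>) * theta_moment 1 (1/2) 0 (2 * \<tau>))"
  proof (rule has_sum_lattice_rotation [OF has_sum_theta_product has_sum_theta_product _ has_sum_cmult_right [OF has_sum_theta_product]])
    fix a b :: int
    show "theta_term (-1) 0 0 \<tau> (fst (a + b, a - b)) * theta_term (-1) 0 0 \<tau> (snd (a + b, a - b)) =
       theta_term 1 0 0 (2 * \<tau>) (fst (a, b)) * theta_term 1 0 0 (2 * \<tau>) (snd (a, b))"
      by (simp add: theta_term_mult_rotate [of _ _ "of_int a" "of_int b"] theta_term_mult [where \<tau> = "2 * \<tau>"] sign_simps,
         simp add: mult_ac sign_simps power_int_minus_one_mult_self')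
    show "theta_term (-1) 0 0 \<tau> (fst (a + b + 1, a - b)) * theta_term (-1) 0 0 \<tau> (snd (a + b + 1, a - b)) =
       (-1) * (theta_term 1 (1/2) 0 (2 * \<tau>) (fst (a, b)) * theta_term 1 (1/2) 0 (2 * \<tau>) (snd (a, b)))"
      by (simp add: theta_term_mult_rotate [of _ _ "of_int a + 1/2" "of_int b + 1/2"] theta_term_mult [where \<tau> = "2 * \<tau>"] sign_simps,
         simp add: mult_ac sign_simps power_int_minus_one_mult_self')
  qed (use assms in auto)
  then show ?thesis
    by (simp add: power2_eq_square)
qed

section \<open>Behaviour at the cusp and descent by doubling\<close>

lemma theta3_eq_moment: "theta3 = theta_moment 1 0 0"
  by (simp add: theta3_def theta_moment_def theta_term_def nome_pow_def fun_eq_iff)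

lemma theta4_eq_moment: "theta4 = theta_moment (-1) 0 0"
  by (simp add: theta4_def theta_moment_def theta_term_def nome_pow_def fun_eq_iff)

lemma theta2_eq_moment: "theta2 = theta_moment 1 (1/2) 0"
proof
  fix \<tau>
  have "exp (1/4 * of_real pi * \<i> * \<tau>) * exp (of_int (k\<^sup>2 + k) * of_real pi * \<i> * \<tau>) = theta_term 1 (1/2) 0 \<tau> k" for k
    by (simp add: theta_term_def nome_pow_def power2_eq_square field_simps flip: exp_add)
  then show "theta2 \<tau> = theta_moment 1 (1/2) 0 \<tau>"
    unfolding theta2_def theta_moment_def by (simp flip: infsum_cmult_right')
qed

lemma Im_pow2_mult [simp]: "Im (2 ^ k * \<tau>) = 2 ^ k * Im \<tau>"
proof -
  have "(2 :: complex) ^ k = of_real (2 ^ k)" by simp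
  then show ?thesis by (metis Im_complex_of_real Re_complex_of_real times_complex.sel(2) add.commute add_0 mult_zero_left)
qed

lemma doubling_exponential_decay:
  fixes a :: real
  assumes "a > 0"
  shows "(\<lambda>k. (2 ^ k) ^ p * exp (- (a * 2 ^ k))) \<longlonglongrightarrow> 0"
proof -
  have "filterlim (\<lambda>k. a * 2 ^ k) at_top sequentially"
    using assms by real_asymp
  from filterlim_compose [OF tendsto_power_div_exp_0 this, of p]
  have "(\<lambda>k. (a * 2 ^ k) ^ p / exp (a * 2 ^ k)) \<longlonglongrightarrow> 0" .
  from tendsto_mult_left [OF this, of "1 / a ^ p"]
  show ?thesis
    using assms by (simp add: power_mult_distrib exp_minus field_simps)
qed

text \<open>
  Once the leading terms, collected in \<open>F\<close>, are removed, the series is of order \<open>\<bar>q\<bar>\<^sup>\<rho>\<close>. Along \<open>2\<^sup>k \<tau>\<close> this decays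
  doubly exponentially in \<open>k\<close>, even after division by \<open>q\<^sup>\<sigma>\<close>, and the factor \<open>(2\<^sup>k)\<^sup>p\<close> is harmless.
\<close>

lemma theta_moment_asymptotic:
  assumes "norm \<epsilon> = 1" "Im \<tau> > 0" "finite F" "\<sigma> < \<rho>"
    and "\<And>n. n \<notin> F \<Longrightarrow> (of_int n + \<delta>)\<^sup>2 \<ge> \<rho>"
  shows "(\<lambda>k. (2 ^ k) ^ p * ((theta_moment \<epsilon> \<delta> j (2 ^ k * \<tau>) - (\<Sum>n\<in>F. theta_term \<epsilon> \<delta> j (2 ^ k * \<tau>) n))
            / nome_pow (2 ^ k * \<tau>) \<sigma>)) \<longlonglongrightarrow> 0"
proof -
  obtain K where K: "\<And>\<tau>. Im \<tau> \<ge> 1 \<Longrightarrow>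
      norm (\<Sum>\<^sub>\<infinity>n\<in>-F. theta_term \<epsilon> \<delta> j \<tau> n) \<le> K * exp (- (pi * \<rho> * Im \<tau>))"
    using theta_tail_bound [of \<epsilon> "-F" \<rho> \<delta> j] assms by auto
  have tail: "theta_moment \<epsilon> \<delta> j \<tau>' - (\<Sum>n\<in>F. theta_term \<epsilon> \<delta> j \<tau>' n) = (\<Sum>\<^sub>\<infinity>n\<in>-F. theta_term \<epsilon> \<delta> j \<tau>' n)"
    if "Im \<tau>' > 0" for \<tau>'
  proof -
    have "(\<Sum>\<^sub>\<infinity>n\<in>UNIV. theta_term \<epsilon> \<delta> j \<tau>' n) =
        (\<Sum>\<^sub>\<infinity>n\<in>F. theta_term \<epsilon> \<delta> j \<tau>' n) + (\<Sum>\<^sub>\<infinity>n\<in>-F. theta_term \<epsilon> \<delta> j \<tau>' n)"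
      using assms(1) that
      by (subst infsum_Un_disjoint [symmetric])
         (auto intro: abs_summable_summable abs_summable_theta_term)
    then show ?thesis
      using assms(3) by (simp add: theta_moment_def)
  qed
  define a where "a = pi * (\<rho> - \<sigma>) * Im \<tau>"
  have "filterlim (\<lambda>k. 2 ^ k * Im \<tau>) at_top sequentially"
    using assms(2) by real_asymp
  then have "\<forall>\<^sub>F k in sequentially. 2 ^ k * Im \<tau> \<ge> 1"
    by (simp add: filterlim_at_top)
  then have "\<forall>\<^sub>F k in sequentially. norm ((2 ^ k) ^ p * ((theta_moment \<epsilon> \<delta> j (2 ^ k * \<tau>) - (\<Sum>n\<in>F. theta_term \<epsilon> \<delta> j (2 ^ k * \<tau>) n))
            / nome_pow (2 ^ k * \<tau>) \<sigma>)) \<le> K * ((2 ^ k) ^ p * exp (- (a * 2 ^ k)))"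
  proof eventually_elim
    case (elim k)
    have "norm ((2 ^ k) ^ p * ((theta_moment \<epsilon> \<delta> j (2 ^ k * \<tau>) - (\<Sum>n\<in>F. theta_term \<epsilon> \<delta> j (2 ^ k * \<tau>) n))
            / nome_pow (2 ^ k * \<tau>) \<sigma>))
        = (2 ^ k) ^ p * (norm (\<Sum>\<^sub>\<infinity>n\<in>-F. theta_term \<epsilon> \<delta> j (2 ^ k * \<tau>) n) * exp (pi * \<sigma> * (2 ^ k * Im \<tau>)))"
      using assms(2) by (simp add: tail norm_mult norm_divide norm_power norm_nome_pow exp_minus divide_inverse mult_ac norm_inverse)
    also have "\<dots> \<le> (2 ^ k) ^ p * (K * exp (- (pi * \<rho> * (2 ^ k * Im \<tau>))) * exp (pi * \<sigma> * (2 ^ k * Im \<tau>)))"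
      using K [of "2 ^ k * \<tau>"] elim by (intro mult_left_mono mult_right_mono) auto
    also have "\<dots> = K * ((2 ^ k) ^ p * exp (- (a * 2 ^ k)))"
      by (simp add: a_def algebra_simps flip: exp_add)
    finally show ?case .
  qed
  moreover have "(\<lambda>k. K * ((2 ^ k) ^ p * exp (- (a * 2 ^ k)))) \<longlonglongrightarrow> 0"
    using assms by (intro tendsto_mult_right_zero doubling_exponential_decay) (simp add: a_def)
  ultimately show ?thesis
    by (rule Lim_null_comparison)
qed

lemma int_square_ge_1: "n \<notin> {0} \<Longrightarrow> (of_int n + 0 :: real)\<^sup>2 \<ge> 1"
proof -
  assume "n \<notin> {0}"
  then have "1 \<le> n\<^sup>2" by (simp add: int_one_le_iff_zero_less)
  then show ?thesis by (simp flip: of_int_power)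
qed

lemma half_int_square_ge: "n \<notin> {0, -1} \<Longrightarrow> (of_int n + 1/2 :: real)\<^sup>2 \<ge> 9/4"
proof -
  assume "n \<notin> {0, -1}"
  then consider "n \<ge> 1" | "n \<le> -2" by fastforce
  then have "3 / 2 \<le> \<bar>of_int n + 1/2 :: real\<bar>"
    by cases linarith+
  then have "(3 / 2)\<^sup>2 \<le> \<bar>of_int n + 1/2 :: real\<bar>\<^sup>2"
    by (intro power_mono) auto
  then show ?thesis by (simp add: power2_eq_square)
qed

lemma half_int_square_ge': "(of_int n + 1/2 :: real)\<^sup>2 \<ge> 1/4"
proof (cases "n \<in> {0, -1}")
  case False
  then show ?thesis using half_int_square_ge [of n] by simp
qed (auto simp: power2_eq_square)

lemma nome_pow_0 [simp]: "nome_pow \<tau> 0 = 1"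
  by (simp add: nome_pow_def)

lemma theta3_tendsto:
  assumes "Im \<tau> > 0" shows "(\<lambda>k. theta3 (2 ^ k * \<tau>)) \<longlonglongrightarrow> 1"
proof -
  have "(\<lambda>k. theta3 (2 ^ k * \<tau>) - 1) \<longlonglongrightarrow> 0"
    using theta_moment_asymptotic [of 1 \<tau> "{0}" 0 1 0 0 0, OF _ _ _ _ int_square_ge_1] assms
    by (simp add: theta3_eq_moment theta_term_def)
  then show ?thesis by (simp add: LIM_zero_iff)
qed

lemma theta4_tendsto:
  assumes "Im \<tau> > 0" shows "(\<lambda>k. theta4 (2 ^ k * \<tau>)) \<longlonglongrightarrow> 1"
proof -
  have "(\<lambda>k. theta4 (2 ^ k * \<tau>) - 1) \<longlonglongrightarrow> 0"
    using theta_moment_asymptotic [of "-1" \<tau> "{0}" 0 1 0 0 0, OF _ _ _ _ int_square_ge_1] assms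
    by (simp add: theta4_eq_moment theta_term_def)
  then show ?thesis by (simp add: LIM_zero_iff)
qed

lemma theta4_moment_decay:
  assumes "Im \<tau> > 0" "j > 0"
  shows "(\<lambda>k. (2 ^ k) ^ p * theta_moment (-1) 0 j (2 ^ k * \<tau>)) \<longlonglongrightarrow> 0"
  using theta_moment_asymptotic [of "-1" \<tau> "{0}" 0 1 0 p j, OF _ _ _ _ int_square_ge_1] assms
  by (simp add: theta_term_def zero_power)

lemma theta2_decay:
  assumes "Im \<tau> > 0"
  shows "(\<lambda>k. (2 ^ k) ^ p * theta2 (2 ^ k * \<tau>)) \<longlonglongrightarrow> 0"
  using theta_moment_asymptotic [of "1" \<tau> "{}" 0 "1/4" "1/2" p 0, OF _ _ _ _ half_int_square_ge'] assms
  by (simp add: theta2_eq_moment)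

lemma theta2_tendsto:
  assumes "Im \<tau> > 0" shows "(\<lambda>k. theta2 (2 ^ k * \<tau>) / nome_pow (2 ^ k * \<tau>) (1/4)) \<longlonglongrightarrow> 2"
proof -
  have "(\<lambda>k. theta2 (2 ^ k * \<tau>) / nome_pow (2 ^ k * \<tau>) (1/4) - 2) \<longlonglongrightarrow> 0"
    using theta_moment_asymptotic [of 1 \<tau> "{0, -1}" "1/4" "9/4" "1/2" 0 0, OF _ _ _ _ half_int_square_ge] assms
    by (simp add: theta2_eq_moment theta_term_def diff_divide_distrib power2_eq_square)
  then show ?thesis by (simp add: LIM_zero_iff)
qed

lemma theta1'_tendsto:
  assumes "Im \<tau> > 0"
  shows "(\<lambda>k. theta_moment (-1) (1/2) 1 (2 ^ k * \<tau>) / nome_pow (2 ^ k * \<tau>) (1/4)) \<longlonglongrightarrow> 1"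
proof -
  have "(\<lambda>k. theta_moment (-1) (1/2) 1 (2 ^ k * \<tau>) / nome_pow (2 ^ k * \<tau>) (1/4) - 1) \<longlonglongrightarrow> 0"
    using theta_moment_asymptotic [of "-1" \<tau> "{0, -1}" "1/4" "9/4" "1/2" 0 1, OF _ _ _ _ half_int_square_ge] assms
    by (simp add: theta_term_def diff_divide_distrib power2_eq_square)
  then show ?thesis by (simp add: LIM_zero_iff)
qed

text \<open>
  Properties are transported from the neighbourhood of \<open>\<i>\<infinity>\<close> to the whole half-plane.
\<close>

lemma doubling_descent:
  assumes "\<And>\<tau>. Im \<tau> > 0 \<Longrightarrow> P (2 * \<tau>) \<Longrightarrow> P \<tau>" "Im \<tau> > 0" "P (2 ^ k * \<tau>)"
  shows "P (\<tau> :: complex)"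
  using assms(2,3)
proof (induction k arbitrary: \<tau>)
  case (Suc k)
  have "P (2 * \<tau>)"
    by (rule Suc.IH) (use Suc.prems in \<open>simp_all add: mult_ac\<close>)
  then show ?case using assms(1) Suc.prems by blast
qed simp

lemma tendsto_imp_ex_nonzero:
  assumes "f \<longlonglongrightarrow> (c :: complex)" "c \<noteq> 0"
  shows "\<exists>k. f k \<noteq> 0"
proof (rule ccontr)
  assume "\<not> (\<exists>k. f k \<noteq> 0)"
  then have "f = (\<lambda>_. 0)" by auto
  then show False using assms by (simp add: LIMSEQ_const_iff)
qed

text \<open>
  By \<open>\<theta>\<^sub>3 \<theta>\<^sub>4 = \<theta>\<^sub>4(2\<tau>)\<^sup>2\<close> a zero of \<open>\<theta>\<^sub>3\<close> or \<open>\<theta>\<^sub>4\<close> at \<open>\<tau>\<close> forces a zero of \<open>\<theta>\<^sub>4\<close> at \<open>2\<tau>\<close>, and so on up to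
  the region where both functions are close to 1.
\<close>

lemma theta3_theta4_nonzero:
  assumes "Im \<tau> > 0" shows "theta3 \<tau> \<noteq> 0 \<and> theta4 \<tau> \<noteq> 0"
proof -
  have "(\<lambda>k. theta3 (2 ^ k * \<tau>) * theta4 (2 ^ k * \<tau>)) \<longlonglongrightarrow> 1 * 1"
    using assms by (intro tendsto_mult theta3_tendsto theta4_tendsto)
  then obtain k where "theta3 (2 ^ k * \<tau>) * theta4 (2 ^ k * \<tau>) \<noteq> 0"
    using tendsto_imp_ex_nonzero by force
  then have k: "theta3 (2 ^ k * \<tau>) \<noteq> 0 \<and> theta4 (2 ^ k * \<tau>) \<noteq> 0" by auto
  show ?thesis
  proof (rule doubling_descent [where P = "\<lambda>\<tau>. theta3 \<tau> \<noteq> 0 \<and> theta4 \<tau> \<noteq> 0", OF _ assms k])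
    fix \<tau> assume \<tau>: "Im \<tau> > 0" "theta3 (2 * \<tau>) \<noteq> 0 \<and> theta4 (2 * \<tau>) \<noteq> 0"
    then show "theta3 \<tau> \<noteq> 0 \<and> theta4 \<tau> \<noteq> 0"
      using theta3_theta4_doubling [OF \<tau>(1)] by (auto simp: theta3_eq_moment theta4_eq_moment)
  qed
qed

lemma theta2_nonzero:
  assumes "Im \<tau> > 0" shows "theta2 \<tau> \<noteq> 0"
proof -
  obtain k where k: "theta2 (2 ^ k * \<tau>) \<noteq> 0"
    using tendsto_imp_ex_nonzero [OF theta2_tendsto [OF assms]] by auto
  show ?thesis
  proof (rule doubling_descent [where P = "\<lambda>\<tau>. theta2 \<tau> \<noteq> 0", OF _ assms k])
    fix \<tau> assume \<tau>: "Im \<tau> > 0" "theta2 (2 * \<tau>) \<noteq> 0"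
    then have "theta3 (2 * \<tau>) \<noteq> 0" using theta3_theta4_nonzero [of "2 * \<tau>"] by simp
    then show "theta2 \<tau> \<noteq> 0"
      using theta2_doubling [OF \<tau>(1)] \<tau>(2) by (auto simp: theta2_eq_moment theta3_eq_moment)
  qed
qed

text \<open>
  Jacobi's \<open>\<theta>\<^sub>1' = \<pi> \<theta>\<^sub>2 \<theta>\<^sub>3 \<theta>\<^sub>4\<close> at the origin. The quotient of the two sides is unchanged by
  doubling, by three of the doubling formulas, hence equals its limit at \<open>\<i>\<infinity>\<close>.
\<close>

lemma jacobi_derivative_formula:
  assumes "Im \<tau> > 0"
  shows "2 * theta_moment (-1) (1/2) 1 \<tau> = theta2 \<tau> * theta3 \<tau> * theta4 \<tau>"
proof -
  define R where "R \<tau> = theta_moment (-1) (1/2) 1 \<tau> / (theta2 \<tau> * theta3 \<tau> * theta4 \<tau>)" for \<tau>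
  have R_double: "R \<tau> = R (2 * \<tau>)" if "Im \<tau> > 0" for \<tau>
  proof -
    have nz: "theta2 \<tau> \<noteq> 0" "theta3 \<tau> \<noteq> 0" "theta4 \<tau> \<noteq> 0"
        "theta2 (2 * \<tau>) \<noteq> 0" "theta3 (2 * \<tau>) \<noteq> 0" "theta4 (2 * \<tau>) \<noteq> 0"
      using that theta2_nonzero theta3_theta4_nonzero by auto
    have "R \<tau> = theta_moment (-1) (1/2) 1 \<tau> * theta2 \<tau> / ((theta2 \<tau>)\<^sup>2 * (theta3 \<tau> * theta4 \<tau>))"
      using nz by (simp add: R_def power2_eq_square)
    also have "\<dots> = 2 * theta_moment (-1) (1/2) 1 (2 * \<tau>) * theta4 (2 * \<tau>) /
        (2 * theta2 (2 * \<tau>) * theta3 (2 * \<tau>) * (theta4 (2 * \<tau>))\<^sup>2)"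
      using theta1'_theta2_doubling [OF that] theta2_doubling [OF that] theta3_theta4_doubling [OF that]
      by (simp add: theta2_eq_moment theta3_eq_moment theta4_eq_moment)
    also have "\<dots> = R (2 * \<tau>)"
      using nz by (simp add: R_def power2_eq_square)
    finally show ?thesis .
  qed
  have R_pow: "R (2 ^ k * \<tau>) = R \<tau>" for k
  proof (induction k)
    case (Suc k)
    then show ?case using R_double [of "2 ^ k * \<tau>"] assms by (simp add: mult_ac)
  qed simp
  have "(\<lambda>k. (theta_moment (-1) (1/2) 1 (2 ^ k * \<tau>) / nome_pow (2 ^ k * \<tau>) (1/4)) /
      ((theta2 (2 ^ k * \<tau>) / nome_pow (2 ^ k * \<tau>) (1/4)) * theta3 (2 ^ k * \<tau>) * theta4 (2 ^ k * \<tau>)))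
      \<longlonglongrightarrow> 1 / (2 * 1 * 1)"
    using assms
    by (intro tendsto_intros theta1'_tendsto theta2_tendsto theta3_tendsto theta4_tendsto) auto
  then have "(\<lambda>k. R (2 ^ k * \<tau>)) \<longlonglongrightarrow> 1 / 2"
    by (simp add: R_def)
  then have "R \<tau> = 1 / 2"
    by (simp add: R_pow LIMSEQ_const_iff)
  moreover have "theta2 \<tau> * theta3 \<tau> * theta4 \<tau> \<noteq> 0"
    using assms theta2_nonzero theta3_theta4_nonzero by simp
  ultimately show ?thesis
    by (simp add: R_def field_simps)
qed

section \<open>Differences of logarithmic derivatives\<close>

lemma theta3_theta4_logderiv:
  assumes "Im \<tau> > 0"
  shows "4 * (theta_moment 1 0 2 \<tau> * theta4 \<tau> - theta3 \<tau> * theta_moment (-1) 0 2 \<tau>) =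
      theta2 \<tau> ^ 4 * (theta3 \<tau> * theta4 \<tau>)"
proof -
  have "theta_moment 1 0 2 \<tau> * theta4 \<tau> - theta3 \<tau> * theta_moment (-1) 0 2 \<tau> =
      (2 * theta_moment (-1) (1/2) 1 (2 * \<tau>))\<^sup>2"
    using theta3_theta4_wronskian [OF assms]
    by (simp add: theta3_eq_moment theta4_eq_moment power_mult_distrib algebra_simps)
  then have "4 * (theta_moment 1 0 2 \<tau> * theta4 \<tau> - theta3 \<tau> * theta_moment (-1) 0 2 \<tau>) =
      4 * (2 * theta_moment (-1) (1/2) 1 (2 * \<tau>))\<^sup>2" by simp
  also have "\<dots> = (2 * theta2 (2 * \<tau>) * theta3 (2 * \<tau>))\<^sup>2 * (theta4 (2 * \<tau>))\<^sup>2"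
    using jacobi_derivative_formula [of "2 * \<tau>"] assms by (simp add: power_mult_distrib)
  also have "\<dots> = ((theta2 \<tau>)\<^sup>2)\<^sup>2 * (theta3 \<tau> * theta4 \<tau>)"
    using theta2_doubling [OF assms] theta3_theta4_doubling [OF assms]
    by (simp add: theta2_eq_moment theta3_eq_moment theta4_eq_moment)
  finally show ?thesis by simp
qed

text \<open>
  The relevant square lives at \<open>\<tau>/2\<close>, whence the halving of the argument.
\<close>

lemma theta2_theta3_logderiv:
  assumes "Im \<tau> > 0"
  shows "4 * (theta_moment 1 (1/2) 2 \<tau> * theta3 \<tau> - theta2 \<tau> * theta_moment 1 0 2 \<tau>) =
      theta4 \<tau> ^ 4 * (theta2 \<tau> * theta3 \<tau>)"
proof -
  define \<sigma> where "\<sigma> = \<tau> / 2"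
  have \<sigma>: "Im \<sigma> > 0" "\<tau> = 2 * \<sigma>"
    using assms by (simp_all add: \<sigma>_def)
  have "2 * (4 * (theta_moment 1 (1/2) 2 \<tau> * theta3 \<tau> - theta2 \<tau> * theta_moment 1 0 2 \<tau>)) =
      (2 * theta_moment (-1) (1/2) 1 \<sigma>)\<^sup>2"
    using theta1'_square [OF \<sigma>(1)]
    by (simp add: \<sigma>(2) theta2_eq_moment theta3_eq_moment power_mult_distrib)
  also have "\<dots> = (theta2 \<sigma>)\<^sup>2 * (theta3 \<sigma> * theta4 \<sigma>)\<^sup>2"
    unfolding jacobi_derivative_formula [OF \<sigma>(1)] by (simp add: power_mult_distrib)
  also have "\<dots> = 2 * (((theta4 \<tau>)\<^sup>2)\<^sup>2 * (theta2 \<tau> * theta3 \<tau>))"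
    using theta2_doubling [OF \<sigma>(1)] theta3_theta4_doubling [OF \<sigma>(1)]
    by (simp add: theta2_eq_moment theta3_eq_moment theta4_eq_moment \<sigma>(2))
  finally show ?thesis
    by (simp only: mult_cancel_left) simp
qed

text \<open>
  \<open>\<theta>\<^sub>3\<^sup>2\<close> and \<open>\<theta>\<^sub>4\<^sup>2\<close> are the sum and the difference of \<open>\<theta>\<^sub>3(2\<tau>)\<^sup>2\<close> and \<open>\<theta>\<^sub>2(2\<tau>)\<^sup>2\<close>, so the difference of their
  squares is \<open>4 \<theta>\<^sub>2(2\<tau>)\<^sup>2 \<theta>\<^sub>3(2\<tau>)\<^sup>2 = \<theta>\<^sub>2\<^sup>4\<close>.
\<close>

lemma jacobi_quartic_identity:
  assumes "Im \<tau> > 0"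
  shows "theta3 \<tau> ^ 4 = theta2 \<tau> ^ 4 + theta4 \<tau> ^ 4"
proof -
  have "theta3 \<tau> ^ 4 - theta4 \<tau> ^ 4 = ((theta3 \<tau>)\<^sup>2)\<^sup>2 - ((theta4 \<tau>)\<^sup>2)\<^sup>2"
    by simp
  also have "\<dots> = (2 * theta2 (2 * \<tau>) * theta3 (2 * \<tau>))\<^sup>2"
    unfolding theta2_eq_moment theta3_eq_moment theta4_eq_moment
      theta3_square_doubling [OF assms] theta4_square_doubling [OF assms]
    by (simp add: power2_eq_square algebra_simps)
  also have "\<dots> = ((theta2 \<tau>)\<^sup>2)\<^sup>2"
    using theta2_doubling [OF assms] by (simp add: theta2_eq_moment theta3_eq_moment)
  finally show ?thesis by (simp add: algebra_simps)
qed

section \<open>The second-order relation\<close>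

lemma has_field_derivative_unique_on_open:
  assumes "(f has_field_derivative D) (at \<tau>)" "(g has_field_derivative D') (at \<tau>)" "open S" "\<tau> \<in> S"
    "\<And>w. w \<in> S \<Longrightarrow> f w = g w"
  shows "D = D'"
  using DERIV_unique has_field_derivative_transform_within_open [OF assms(1,3,4,5)] assms(2) by blast

lemma open_upper_half_plane: "open upper_half_plane"
  unfolding upper_half_plane_def by (rule open_halfspace_Im_gt)

lemma theta_deriv:
  assumes "Im \<tau> > 0"
  shows theta2_deriv: "(theta2 has_field_derivative \<i> * of_real pi * theta_moment 1 (1/2) 2 \<tau>) (at \<tau>)"
    and theta3_deriv: "(theta3 has_field_derivative \<i> * of_real pi * theta_moment 1 0 2 \<tau>) (at \<tau>)"
    and theta4_deriv: "(theta4 has_field_derivative \<i> * of_real pi * theta_moment (-1) 0 2 \<tau>) (at \<tau>)"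
    and theta3_deriv2: "(theta_moment 1 0 2 has_field_derivative \<i> * of_real pi * theta_moment 1 0 4 \<tau>) (at \<tau>)"
    and theta4_deriv2: "(theta_moment (-1) 0 2 has_field_derivative \<i> * of_real pi * theta_moment (-1) 0 4 \<tau>) (at \<tau>)"
  using has_field_derivative_theta_moment [of 1 \<tau> "1/2" 0] has_field_derivative_theta_moment [of 1 \<tau> 0 0]
    has_field_derivative_theta_moment [of "-1" \<tau> 0 0] has_field_derivative_theta_moment [of 1 \<tau> 0 2]
    has_field_derivative_theta_moment [of "-1" \<tau> 0 2] assms
  by (simp_all add: theta2_eq_moment theta3_eq_moment theta4_eq_moment numeral_2_eq_2 eval_nat_numeral)

text \<open>
  The one quantity, \<open>D log \<theta>\<^sub>4\<close>, through which all first derivatives and \<open>\<eta>\<close> are expressed, with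
  theta-constants as the only other ingredients.
\<close>

definition theta4_logderiv :: "complex \<Rightarrow> complex" where
  "theta4_logderiv \<tau> = theta_moment (-1) 0 2 \<tau> / theta4 \<tau>"

lemma theta3_moment2:
  assumes "Im \<tau> > 0"
  shows "theta_moment 1 0 2 \<tau> = theta3 \<tau> * (theta4_logderiv \<tau> + theta2 \<tau> ^ 4 / 4)"
  using theta3_theta4_logderiv [OF assms] theta3_theta4_nonzero [OF assms]
  by (simp add: theta4_logderiv_def field_simps)

lemma theta2_moment2:
  assumes "Im \<tau> > 0"
  shows "theta_moment 1 (1/2) 2 \<tau> = theta2 \<tau> * (theta4_logderiv \<tau> + theta3 \<tau> ^ 4 / 4)"
proof -
  have "theta_moment 1 (1/2) 2 \<tau> = theta2 \<tau> * (theta_moment 1 0 2 \<tau> / theta3 \<tau> + theta4 \<tau> ^ 4 / 4)"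
    using theta2_theta3_logderiv [OF assms] theta3_theta4_nonzero [OF assms]
    by (simp add: field_simps)
  also have "\<dots> = theta2 \<tau> * (theta4_logderiv \<tau> + (theta2 \<tau> ^ 4 + theta4 \<tau> ^ 4) / 4)"
    using theta3_theta4_nonzero [OF assms] by (simp add: theta3_moment2 [OF assms] field_simps)
  finally show ?thesis
    by (simp add: jacobi_quartic_identity [OF assms])
qed

lemma theta4_moment2:
  assumes "Im \<tau> > 0"
  shows "theta_moment (-1) 0 2 \<tau> = theta4 \<tau> * theta4_logderiv \<tau>"
  using theta3_theta4_nonzero [OF assms] by (simp add: theta4_logderiv_def)

lemma theta4_logderiv_deriv:
  assumes "Im \<tau> > 0"
  shows "(theta4_logderiv has_field_derivative
     \<i> * of_real pi * (theta_moment (-1) 0 4 \<tau> / theta4 \<tau> - (theta4_logderiv \<tau>)\<^sup>2)) (at \<tau>)"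
  unfolding theta4_logderiv_def using assms theta3_theta4_nonzero [OF assms]
  by (auto intro!: derivative_eq_intros theta4_deriv2 theta4_deriv simp: field_simps power2_eq_square)

text \<open>
  Differentiating \<open>D\<theta>\<^sub>3 = \<theta>\<^sub>3 (D log \<theta>\<^sub>4 + \<theta>\<^sub>2\<^sup>4/4)\<close> once more expresses \<open>D\<^sup>2\<theta>\<^sub>3\<close> through \<open>D\<^sup>2\<theta>\<^sub>4\<close>, so that
  the mixed bracket of \<open>\<theta>\<^sub>3\<close> and \<open>\<theta>\<^sub>4\<close> can be compared with that of \<open>\<theta>\<^sub>4\<close> alone.
\<close>

lemma theta3_moment4:
  assumes "Im \<tau> > 0"
  shows "theta_moment 1 0 4 \<tau> = theta3 \<tau> * (theta_moment (-1) 0 4 \<tau> / theta4 \<tau>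
     + 3/2 * theta2 \<tau> ^ 4 * theta4_logderiv \<tau> + theta2 \<tau> ^ 4 * theta3 \<tau> ^ 4 / 4 + theta2 \<tau> ^ 8 / 16)"
proof -
  define p A B where "p = theta4_logderiv \<tau>" and "A = theta2 \<tau> ^ 4" and "B = theta3 \<tau> ^ 4"
  define w where "w = theta_moment (-1) 0 4 \<tau> / theta4 \<tau>"
  have "((\<lambda>\<tau>. theta3 \<tau> * (theta4_logderiv \<tau> + theta2 \<tau> ^ 4 / 4)) has_field_derivative
      \<i> * of_real pi * theta_moment 1 0 2 \<tau> * (theta4_logderiv \<tau> + theta2 \<tau> ^ 4 / 4) +
      theta3 \<tau> * (\<i> * of_real pi * (theta_moment (-1) 0 4 \<tau> / theta4 \<tau> - (theta4_logderiv \<tau>)\<^sup>2) +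
        theta2 \<tau> ^ 3 * (\<i> * of_real pi * theta_moment 1 (1/2) 2 \<tau>))) (at \<tau>)"
    by (auto intro!: derivative_eq_intros theta3_deriv theta2_deriv theta4_logderiv_deriv assms)
  from has_field_derivative_unique_on_open [OF theta3_deriv2 [OF assms] this open_upper_half_plane]
  have "\<i> * of_real pi * theta_moment 1 0 4 \<tau> =
      \<i> * of_real pi * theta_moment 1 0 2 \<tau> * (p + A / 4) +
      theta3 \<tau> * (\<i> * of_real pi * (w - p\<^sup>2) +
        theta2 \<tau> ^ 3 * (\<i> * of_real pi * theta_moment 1 (1/2) 2 \<tau>))"
    using assms theta3_moment2 by (simp add: upper_half_plane_def p_def A_def w_def)
  also have "\<dots> = \<i> * of_real pi * (theta3 \<tau> * ((p + A / 4)\<^sup>2 + w - p\<^sup>2 + A * (p + B / 4)))"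
    unfolding theta3_moment2 [OF assms] theta2_moment2 [OF assms] p_def [symmetric] A_def [symmetric] B_def [symmetric]
    by (simp add: A_def field_simps power2_eq_square eval_nat_numeral)
  finally have "theta_moment 1 0 4 \<tau> = theta3 \<tau> * ((p + A / 4)\<^sup>2 + w - p\<^sup>2 + A * (p + B / 4))"
    by simp
  also have "\<dots> = theta3 \<tau> * (w + 3/2 * A * p + A * B / 4 + A\<^sup>2 / 16)"
    by (simp add: power2_eq_square field_simps)
  also have "A\<^sup>2 = theta2 \<tau> ^ 8"
    by (simp add: A_def flip: power_mult)
  finally show ?thesis
    by (simp add: w_def p_def A_def B_def)
qed

text \<open>
  The quantity \<open>T\<close>, twice the difference of the two sides, satisfies \<open>T(\<tau>) = - 4 T(2\<tau>)\<close>: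
  after division by \<open>\<theta>\<^sub>4(2\<tau>)\<^sup>2 = \<theta>\<^sub>3 \<theta>\<^sub>4\<close> the bracket identity relates its derivative parts, and
  \<open>(\<theta>\<^sub>2 \<theta>\<^sub>3)(2\<tau>) = \<theta>\<^sub>2\<^sup>2/2\<close> takes care of the theta-constants. As \<open>4\<^sup>k T(2\<^sup>k \<tau>)\<close> tends to 0 while its modulus is
  independent of \<open>k\<close>, \<open>T\<close> vanishes.
\<close>

lemma theta4_second_bracket:
  assumes "Im \<tau> > 0"
  shows "theta_moment (-1) 0 4 \<tau> / theta4 \<tau> = 3 * (theta4_logderiv \<tau>)\<^sup>2 - theta2 \<tau> ^ 4 * theta3 \<tau> ^ 4 / 8"
proof -
  define T where "T \<tau> = 2 * theta_moment (-1) 0 4 \<tau> / theta4 \<tau> - 6 * (theta4_logderiv \<tau>)\<^sup>2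
     + theta2 \<tau> ^ 4 * theta3 \<tau> ^ 4 / 4" for \<tau>
  have T_double: "T \<tau> = - 4 * T (2 * \<tau>)" if "Im \<tau> > 0" for \<tau>
  proof -
    define p A B w where "p = theta4_logderiv \<tau>" and "A = theta2 \<tau> ^ 4" and "B = theta3 \<tau> ^ 4"
      and "w = theta_moment (-1) 0 4 \<tau> / theta4 \<tau>"
    have nz: "theta3 \<tau> \<noteq> 0" "theta4 \<tau> \<noteq> 0" "theta4 (2 * \<tau>) \<noteq> 0"
      using that theta3_theta4_nonzero by auto
    have w: "theta_moment (-1) 0 4 \<tau> = theta4 \<tau> * w"
      using nz by (simp add: w_def)
    have "theta2 (2 * \<tau>) ^ 4 * theta3 (2 * \<tau>) ^ 4 = (2 * theta2 (2 * \<tau>) * theta3 (2 * \<tau>)) ^ 4 / 16"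
      by (simp add: power_mult_distrib)
    also have "2 * theta2 (2 * \<tau>) * theta3 (2 * \<tau>) = (theta2 \<tau>)\<^sup>2"
      using theta2_doubling [OF that] by (simp add: theta2_eq_moment theta3_eq_moment)
    also have "((theta2 \<tau>)\<^sup>2) ^ 4 = A\<^sup>2"
      by (simp add: A_def flip: power_mult)
    finally have AB: "theta2 (2 * \<tau>) ^ 4 * theta3 (2 * \<tau>) ^ 4 = A\<^sup>2 / 16" .
    have "2 * theta_moment (-1) 0 4 (2 * \<tau>) / theta4 (2 * \<tau>) - 6 * (theta4_logderiv (2 * \<tau>))\<^sup>2 =
        (2 * theta_moment (-1) 0 4 (2 * \<tau>) * theta4 (2 * \<tau>) - 6 * (theta_moment (-1) 0 2 (2 * \<tau>))\<^sup>2) /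
        (theta4 (2 * \<tau>))\<^sup>2"
      using nz by (simp add: theta4_logderiv_def field_simps power2_eq_square)
    also have "(theta4 (2 * \<tau>))\<^sup>2 = theta3 \<tau> * theta4 \<tau>"
      using theta3_theta4_doubling [OF that] by (simp add: theta3_eq_moment theta4_eq_moment)
    finally have "- 4 * (2 * theta_moment (-1) 0 4 (2 * \<tau>) / theta4 (2 * \<tau>) - 6 * (theta4_logderiv (2 * \<tau>))\<^sup>2) =
        (theta_moment 1 0 4 \<tau> * theta4 \<tau> + theta3 \<tau> * theta_moment (-1) 0 4 \<tau> -
         6 * theta_moment 1 0 2 \<tau> * theta_moment (-1) 0 2 \<tau>) / (theta3 \<tau> * theta4 \<tau>)"
      using theta3_theta4_second_bracket [OF that] by (simp add: theta3_eq_moment theta4_eq_moment)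
    also have "\<dots> = (w + 3/2 * A * p + A * B / 4 + A\<^sup>2 / 16) + w - 6 * (p + A / 4) * p"
      unfolding theta3_moment4 [OF that] theta3_moment2 [OF that] theta4_moment2 [OF that]
      unfolding w using nz
      by (simp add: p_def [symmetric] A_def [symmetric] B_def [symmetric] field_simps)
         (simp add: A_def power2_eq_square algebra_simps flip: power_add)
    finally have "- 4 * T (2 * \<tau>) = (w + 3/2 * A * p + A * B / 4 + A\<^sup>2 / 16) + w - 6 * (p + A / 4) * p - A\<^sup>2 / 16"
      unfolding T_def distrib_left AB by simp
    also have "\<dots> = 2 * w - 6 * p\<^sup>2 + A * B / 4"
      by (simp add: power2_eq_square field_simps)
    also have "\<dots> = T \<tau>"
      by (simp add: T_def p_def A_def B_def w_def)
    finally show ?thesis by simp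
  qed
  \<comment> \<open>the factor \<open>4\<^sup>k = (2\<^sup>k)\<^sup>2\<close> is written as in the decay lemmas\<close>
  have T_pow: "norm (T \<tau>) = norm ((2 ^ k) ^ 2 * T (2 ^ k * \<tau>))" for k
  proof (induction k)
    case (Suc k)
    have "T (2 ^ k * \<tau>) = - 4 * T (2 ^ Suc k * \<tau>)"
      using T_double [of "2 ^ k * \<tau>"] assms by (simp add: mult_ac)
    then show ?case using Suc by (simp add: norm_mult norm_power power_mult_distrib)
  qed simp
  have "(\<lambda>k. 2 * ((2 ^ k) ^ 2 * theta_moment (-1) 0 4 (2 ^ k * \<tau>)) / theta4 (2 ^ k * \<tau>) -
       6 * (((2 ^ k) ^ 2 * theta_moment (-1) 0 2 (2 ^ k * \<tau>)) * ((2 ^ k) ^ 0 * theta_moment (-1) 0 2 (2 ^ k * \<tau>))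
         / (theta4 (2 ^ k * \<tau>))\<^sup>2) +
       ((2 ^ k) ^ 2 * theta2 (2 ^ k * \<tau>)) * ((2 ^ k) ^ 0 * theta2 (2 ^ k * \<tau>)) ^ 3 * theta3 (2 ^ k * \<tau>) ^ 4 / 4) \<longlonglongrightarrow>
       2 * 0 / 1 - 6 * (0 * 0 / 1\<^sup>2) + 0 * 0 ^ 3 * 1 ^ 4 / 4"
    using assms
    by (intro tendsto_intros theta4_moment_decay theta2_decay theta3_tendsto theta4_tendsto) auto
  also have "(\<lambda>k. 2 * ((2 ^ k) ^ 2 * theta_moment (-1) 0 4 (2 ^ k * \<tau>)) / theta4 (2 ^ k * \<tau>) -
       6 * (((2 ^ k) ^ 2 * theta_moment (-1) 0 2 (2 ^ k * \<tau>)) * ((2 ^ k) ^ 0 * theta_moment (-1) 0 2 (2 ^ k * \<tau>))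
         / (theta4 (2 ^ k * \<tau>))\<^sup>2) +
       ((2 ^ k) ^ 2 * theta2 (2 ^ k * \<tau>)) * ((2 ^ k) ^ 0 * theta2 (2 ^ k * \<tau>)) ^ 3 * theta3 (2 ^ k * \<tau>) ^ 4 / 4) =
      (\<lambda>k. (2 ^ k) ^ 2 * T (2 ^ k * \<tau>))"
    by (simp add: T_def theta4_logderiv_def fun_eq_iff power_divide eval_nat_numeral algebra_simps)
  finally have "(\<lambda>k. (2 ^ k) ^ 2 * T (2 ^ k * \<tau>)) \<longlonglongrightarrow> 0"
    by simp
  then have "(\<lambda>k. norm ((2 ^ k) ^ 2 * T (2 ^ k * \<tau>))) \<longlonglongrightarrow> 0"
    by (rule tendsto_norm_zero)
  then have "norm (T \<tau>) = 0"
    unfolding T_pow [symmetric] by (simp add: LIMSEQ_const_iff)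
  then show ?thesis
    by (simp add: T_def field_simps)
qed

section \<open>The product for the derivative of the first theta function\<close>

text \<open>
  The integral powers \<open>x\<^sup>k\<close> of \<open>x = q\<^sup>2\<close>, with negative exponents allowed.
\<close>

definition qpow :: "complex \<Rightarrow> int \<Rightarrow> complex" where
  "qpow \<tau> k = nome_pow \<tau> (2 * of_int k)"

text \<open>
  The partial product \<open>(x; x)\<^sub>n\<close> of Euler's product.
\<close>

definition euler_prod :: "complex \<Rightarrow> nat \<Rightarrow> complex" where
  "euler_prod \<tau> n = (\<Prod>k<n. 1 - qpow \<tau> (1 + int k))"

text \<open>
  The convention \<open>1/(x; x)\<^sub>k = 0\<close> for negative \<open>k\<close> makes the recurrence below hold for all integers
  and cuts the sums off at both ends.
\<close>

definition inv_euler_prod :: "complex \<Rightarrow> int \<Rightarrow> complex" where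
  "inv_euler_prod \<tau> k = (if k < 0 then 0 else 1 / euler_prod \<tau> (nat k))"

lemma qpow_add: "qpow \<tau> (j + k) = qpow \<tau> j * qpow \<tau> k"
  by (simp add: qpow_def nome_pow_add algebra_simps)

lemma qpow_nat: "qpow \<tau> (int k) = qpow \<tau> 1 ^ k"
  by (simp add: qpow_def nome_pow_def mult_ac flip: exp_of_nat_mult)

lemma qpow_0 [simp]: "qpow \<tau> 0 = 1"
  by (simp add: qpow_def)

lemma norm_qpow_less_1:
  assumes "Im \<tau> > 0" "k > 0" shows "norm (qpow \<tau> k) < 1"
  using assms by (simp add: qpow_def norm_nome_pow)

lemma qpow_factor_nonzero:
  assumes "Im \<tau> > 0" "k > 0" shows "1 - qpow \<tau> k \<noteq> 0"
  using norm_qpow_less_1 [OF assms] by auto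

lemma inv_euler_prod_pred:
  assumes "Im \<tau> > 0"
  shows "inv_euler_prod \<tau> (k - 1) = (1 - qpow \<tau> k) * inv_euler_prod \<tau> k"
proof (cases "k > 0")
  case True
  then have "nat k = Suc (nat (k - 1))" by simp
  moreover have "1 + int (nat (k - 1)) = k" using True by simp
  ultimately have "euler_prod \<tau> (nat k) = euler_prod \<tau> (nat (k - 1)) * (1 - qpow \<tau> k)"
    by (simp add: euler_prod_def)
  then show ?thesis
    using True qpow_factor_nonzero [OF assms True] by (simp add: inv_euler_prod_def)
qed (auto simp: inv_euler_prod_def)

text \<open>
  Up to the factor \<open>(x; x)_(2n+1)\<close> the second factor is the Gaussian binomial coefficient, in base
  \<open>x\<close>, of \<open>2n + 1\<close> over \<open>n - m\<close>. The sums over \<open>m\<close> are finite, and for \<open>n \<rightarrow> \<infinity>\<close> the second factor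
  tends to a limit independent of \<open>m\<close>.
\<close>

definition finite_theta_term :: "complex \<Rightarrow> nat \<Rightarrow> nat \<Rightarrow> int \<Rightarrow> complex" where
  "finite_theta_term \<tau> j n m = theta_term (-1) (1/2) j \<tau> m *
     (inv_euler_prod \<tau> (int n - m) * inv_euler_prod \<tau> (int n + m + 1))"

lemma theta_term_alternating_succ:
  "theta_term (-1) (1/2) 0 \<tau> (m + 1) = - (qpow \<tau> (m + 1) * theta_term (-1) (1/2) 0 \<tau> m)"
proof -
  have "(of_int (m + 1) + 1/2)\<^sup>2 = 2 * of_int (m + 1) + (of_int m + 1/2 :: real)\<^sup>2"
    by (simp add: power2_eq_square field_simps)
  then show ?thesis
    by (simp add: theta_term_def qpow_def nome_pow_add power_int_add)
qed

text \<open>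
  Up to normalisation the terms are the coefficients of the Laurent polynomial
  \<open>(1 - 1/z) \<Prod>k\<le>n. (1 - z x\<^sup>k)(1 - x\<^sup>k / z)\<close>. The recurrence is multiplication by the factor for \<open>n + 1\<close>. With
  \<open>u = x^(n + 1 - m)\<close>, \<open>v = x^(n + m + 2)\<close>, \<open>y = 1/x\<close> it comes down to
  \<open>(1 - u v y)(1 - u v) = (1 + u v y)(1 - u)(1 - v) + u (1 - v y)(1 - v) + v (1 - u y)(1 - u)\<close>.
\<close>

lemma finite_theta_term_recurrence:
  assumes "Im \<tau> > 0"
  shows "(1 - qpow \<tau> (2 * int n + 2)) * (1 - qpow \<tau> (2 * int n + 3)) * finite_theta_term \<tau> 0 (Suc n) m =
     (1 + qpow \<tau> (2 * int n + 2)) * finite_theta_term \<tau> 0 n m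
     - qpow \<tau> (int n + 1) * (finite_theta_term \<tau> 0 n (m - 1) + finite_theta_term \<tau> 0 n (m + 1))"
proof -
  define y u v s where "y = qpow \<tau> (- 1)" and "u = qpow \<tau> (int n + 1 - m)" and "v = qpow \<tau> (int n + m + 2)"
    and "s = theta_term (-1) (1/2) 0 \<tau> m"
  define a b where "a = inv_euler_prod \<tau> (int n + 1 - m)" and "b = inv_euler_prod \<tau> (int n + m + 2)"
  note pred = inv_euler_prod_pred [OF assms]
  have q: "qpow \<tau> (2 * int n + 3) = u * v" "qpow \<tau> (2 * int n + 2) = u * v * y"
    "qpow \<tau> (int n - m) = u * y" "qpow \<tau> (int n + m + 1) = v * y"
    "qpow \<tau> (int n + 1) * qpow \<tau> (m + 1) = v" "qpow \<tau> (int n + 1) = u * qpow \<tau> m"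
    by (simp_all add: u_def v_def y_def algebra_simps flip: qpow_add)
  have e1: "inv_euler_prod \<tau> (int n - m) = (1 - u) * a"
    using pred [of "int n + 1 - m"] by (simp add: u_def a_def algebra_simps)
  have e2: "inv_euler_prod \<tau> (int n + m + 1) = (1 - v) * b"
    using pred [of "int n + m + 2"] by (simp add: v_def b_def algebra_simps)
  have e3: "inv_euler_prod \<tau> (int n - m - 1) = (1 - u * y) * ((1 - u) * a)"
    using pred [of "int n - m"] by (simp add: q e1)
  have e4: "inv_euler_prod \<tau> (int n + m) = (1 - v * y) * ((1 - v) * b)"
    using pred [of "int n + m + 1"] by (simp add: q e2)
  have b0: "finite_theta_term \<tau> 0 n m = s * ((1 - u) * a * ((1 - v) * b))"
    by (simp add: finite_theta_term_def s_def e1 e2)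
  have b1: "finite_theta_term \<tau> 0 (Suc n) m = s * (a * b)"
    by (simp add: finite_theta_term_def s_def a_def b_def algebra_simps)
  have idx: "int n - (m - 1) = int n + 1 - m" "int n + (m - 1) + 1 = int n + m"
    "int n - (m + 1) = int n - m - 1" "int n + (m + 1) + 1 = int n + m + 2" by simp_all
  have b2: "qpow \<tau> (int n + 1) * finite_theta_term \<tau> 0 n (m + 1) = - v * s * ((1 - u * y) * ((1 - u) * a) * b)"
    unfolding finite_theta_term_def theta_term_alternating_succ q(5) [symmetric] idx e3 s_def [symmetric] b_def [symmetric]
    by simp
  have s: "s = - (qpow \<tau> m * theta_term (-1) (1/2) 0 \<tau> (m - 1))"
    using theta_term_alternating_succ [of \<tau> "m - 1"] by (simp add: s_def)
  have b3: "qpow \<tau> (int n + 1) * finite_theta_term \<tau> 0 n (m - 1) = - u * s * (a * ((1 - v * y) * ((1 - v) * b)))"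
    unfolding finite_theta_term_def q(6) idx e4 s a_def [symmetric] by simp
  show ?thesis
    unfolding distrib_left b0 b1 b2 b3 q(1,2) by (simp add: algebra_simps)
qed

lemma euler_prod_limit_and_bound:
  assumes "Im \<tau> > 0"
  obtains P C where "P \<noteq> 0" "euler_prod \<tau> \<longlonglongrightarrow> P" "\<And>k. norm (inv_euler_prod \<tau> k) \<le> C"
proof -
  have "summable (\<lambda>k. norm (qpow \<tau> 1) ^ Suc k)"
    using norm_qpow_less_1 [OF assms, of 1] by (subst summable_Suc_iff) (auto intro!: summable_geometric)
  then have "abs_convergent_prod (\<lambda>k. 1 - qpow \<tau> (1 + int k))"
    unfolding abs_convergent_prod_conv_summable
    by (simp add: qpow_add qpow_nat norm_mult norm_power)
  then have conv: "convergent_prod (\<lambda>k. 1 - qpow \<tau> (1 + int k))"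
    by (rule abs_convergent_prod_imp_convergent_prod)
  define P where "P = prodinf (\<lambda>k. 1 - qpow \<tau> (1 + int k))"
  have P: "P \<noteq> 0"
    unfolding P_def using qpow_factor_nonzero [OF assms] by (intro prodinf_nonzero conv) simp
  have lim: "euler_prod \<tau> \<longlonglongrightarrow> P"
    using convergent_prod_LIMSEQ [OF conv]
    by (simp add: P_def euler_prod_def [abs_def] LIMSEQ_lessThan_iff_atMost)
  have "(\<lambda>n. 1 / euler_prod \<tau> n) \<longlonglongrightarrow> 1 / P"
    by (intro tendsto_intros lim P)
  then have "Bseq (\<lambda>n. 1 / euler_prod \<tau> n)"
    by (intro convergent_imp_Bseq convergentI)
  then obtain C where "C > 0" "\<And>n. norm (1 / euler_prod \<tau> n) \<le> C"
    by (auto simp: Bseq_def)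
  then have "norm (inv_euler_prod \<tau> k) \<le> C" for k
    by (simp add: inv_euler_prod_def)
  with P lim show thesis by (rule that)
qed

lemma finite_theta_term_dominated:
  assumes "Im \<tau> > 0"
  obtains C where "\<And>j n m. norm (finite_theta_term \<tau> j n m) \<le> norm (theta_term (-1) (1/2) j \<tau> m) * C"
proof -
  obtain C where C: "\<And>k. norm (inv_euler_prod \<tau> k) \<le> C"
    using euler_prod_limit_and_bound [OF assms] by metis
  have "C \<ge> 0" using C [of 0] norm_ge_zero order_trans by blast
  then have "norm (finite_theta_term \<tau> j n m) \<le> norm (theta_term (-1) (1/2) j \<tau> m) * (C * C)" for j n m
    unfolding finite_theta_term_def norm_mult by (intro mult_left_mono mult_mono C) auto
  then show thesis by (rule that)
qed

lemma summable_finite_theta_term: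
  assumes "Im \<tau> > 0"
  shows "finite_theta_term \<tau> j n summable_on UNIV"
proof -
  obtain C where C: "\<And>j n m. norm (finite_theta_term \<tau> j n m) \<le> norm (theta_term (-1) (1/2) j \<tau> m) * C"
    using finite_theta_term_dominated [OF assms] by metis
  have "(\<lambda>m. norm (theta_term (-1) (1/2) j \<tau> m) * C) summable_on UNIV"
    using assms by (intro summable_on_cmult_left abs_summable_theta_term) simp_all
  then have "(\<lambda>m. norm (finite_theta_term \<tau> j n m)) summable_on UNIV"
    by (rule Infinite_Sum.abs_summable_on_comparison_test') (rule C)
  then show ?thesis
    by (rule abs_summable_summable)
qed

lemma finite_theta_term_weight:
  "finite_theta_term \<tau> 1 n m = (of_int m + 1/2) * finite_theta_term \<tau> 0 n m"
  by (simp add: finite_theta_term_def theta_term_def)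

text \<open>
  Summation with weight \<open>m + 1/2\<close> is the derivative at \<open>z = 1\<close> of the Laurent polynomial above, which
  vanishes there; the factor that is new for \<open>n + 1\<close> has the value \<open>(1 - x^(n + 1))\<^sup>2\<close>.
\<close>

lemma finite_jacobi_identity:
  assumes "Im \<tau> > 0"
  shows "(finite_theta_term \<tau> 1 n has_sum nome_pow \<tau> (1/4) * (euler_prod \<tau> n)\<^sup>2 / euler_prod \<tau> (2 * n + 1)) UNIV"
proof (induction n)
  case 0
  show ?case
  proof (rule has_sum_finite_neutralI [where B = "{0, -1}"])
    fix m :: int
    assume "m \<in> UNIV - {0, -1}"
    then have "- m < 0 \<or> m + 1 < 0" by auto
    then show "finite_theta_term \<tau> 1 0 m = 0"
      by (auto simp: finite_theta_term_def inv_euler_prod_def)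
  next
    show "nome_pow \<tau> (1/4) * (euler_prod \<tau> 0)\<^sup>2 / euler_prod \<tau> (2 * 0 + 1) = sum (finite_theta_term \<tau> 1 0) {0, -1}"
      by (simp add: finite_theta_term_def inv_euler_prod_def theta_term_def euler_prod_def power2_eq_square
          del: right_diff_distrib_numeral left_diff_distrib_numeral)
  qed auto
next
  case (Suc n)
  \<comment> \<open>\<open>F0\<close>, the sum without weight, enters through both index shifts with opposite signs and cancels\<close>
  define F where "F = nome_pow \<tau> (1/4) * (euler_prod \<tau> n)\<^sup>2 / euler_prod \<tau> (2 * n + 1)"
  define F0 where "F0 = infsum (finite_theta_term \<tau> 0 n) UNIV"
  define N where "N = (1 - qpow \<tau> (2 * int n + 2)) * (1 - qpow \<tau> (2 * int n + 3))"
  have N: "N \<noteq> 0"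
    using qpow_factor_nonzero [OF assms, of "2 * int n + 2"] qpow_factor_nonzero [OF assms, of "2 * int n + 3"]
    by (simp add: N_def)
  have h1: "((\<lambda>m. (of_int m + 1/2) * finite_theta_term \<tau> 0 n m) has_sum F) UNIV"
    using Suc by (simp add: F_def flip: finite_theta_term_weight)
  have h0: "(finite_theta_term \<tau> 0 n has_sum F0) UNIV"
    unfolding F0_def by (intro has_sum_infsum summable_finite_theta_term assms)
  have "((\<lambda>m. (of_int m + 1/2) * finite_theta_term \<tau> 0 n (m - 1)) has_sum F + F0) UNIV"
    by (subst has_sum_reindex_bij_witness [where i = "\<lambda>m. m + 1" and j = "\<lambda>m. m - 1" and T = UNIV
        and h = "\<lambda>m. (of_int m + 1/2) * finite_theta_term \<tau> 0 n m + finite_theta_term \<tau> 0 n m", OF _ _ _ _ _ refl])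
       (use has_sum_add [OF h1 h0] in \<open>auto simp: algebra_simps\<close>)
  moreover have "((\<lambda>m. (of_int m + 1/2) * finite_theta_term \<tau> 0 n (m + 1)) has_sum F + (-1) * F0) UNIV"
    by (subst has_sum_reindex_bij_witness [where i = "\<lambda>m. m - 1" and j = "\<lambda>m. m + 1" and T = UNIV
        and h = "\<lambda>m. (of_int m + 1/2) * finite_theta_term \<tau> 0 n m + (-1) * finite_theta_term \<tau> 0 n m", OF _ _ _ _ _ refl])
       (use has_sum_add [OF h1 has_sum_cmult_right [OF h0, of "-1"]] in \<open>auto simp: algebra_simps\<close>)
  ultimately have "((\<lambda>m. (1 + qpow \<tau> (2 * int n + 2)) * ((of_int m + 1/2) * finite_theta_term \<tau> 0 n m) +
      (- qpow \<tau> (int n + 1)) * ((of_int m + 1/2) * finite_theta_term \<tau> 0 n (m - 1) + (of_int m + 1/2) * finite_theta_term \<tau> 0 n (m + 1)))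
     has_sum (1 + qpow \<tau> (2 * int n + 2)) * F + (- qpow \<tau> (int n + 1)) * ((F + F0) + (F + (-1) * F0))) UNIV"
    by (intro has_sum_add has_sum_cmult_right h1)
  also have "(\<lambda>m. (1 + qpow \<tau> (2 * int n + 2)) * ((of_int m + 1/2) * finite_theta_term \<tau> 0 n m) +
      (- qpow \<tau> (int n + 1)) * ((of_int m + 1/2) * finite_theta_term \<tau> 0 n (m - 1) + (of_int m + 1/2) * finite_theta_term \<tau> 0 n (m + 1)))
     = (\<lambda>m. N * finite_theta_term \<tau> 1 (Suc n) m)"
  proof
    fix m
    have "N * finite_theta_term \<tau> 1 (Suc n) m = (of_int m + 1/2) * (N * finite_theta_term \<tau> 0 (Suc n) m)"
      unfolding finite_theta_term_weight by simp
    also have "\<dots> = (1 + qpow \<tau> (2 * int n + 2)) * ((of_int m + 1/2) * finite_theta_term \<tau> 0 n m) +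
      (- qpow \<tau> (int n + 1)) * ((of_int m + 1/2) * finite_theta_term \<tau> 0 n (m - 1) + (of_int m + 1/2) * finite_theta_term \<tau> 0 n (m + 1))"
      unfolding N_def finite_theta_term_recurrence [OF assms] by (simp add: algebra_simps)
    finally show "(1 + qpow \<tau> (2 * int n + 2)) * ((of_int m + 1/2) * finite_theta_term \<tau> 0 n m) +
      (- qpow \<tau> (int n + 1)) * ((of_int m + 1/2) * finite_theta_term \<tau> 0 n (m - 1) + (of_int m + 1/2) * finite_theta_term \<tau> 0 n (m + 1))
      = N * finite_theta_term \<tau> 1 (Suc n) m" ..
  qed
  also have "(1 + qpow \<tau> (2 * int n + 2)) * F + (- qpow \<tau> (int n + 1)) * ((F + F0) + (F + (-1) * F0)) =
      (1 - qpow \<tau> (int n + 1))\<^sup>2 * F"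
    using qpow_add [of \<tau> "int n + 1" "int n + 1"] by (simp add: power2_eq_square algebra_simps)
  finally have "((\<lambda>m. N * finite_theta_term \<tau> 1 (Suc n) m) has_sum (1 - qpow \<tau> (int n + 1))\<^sup>2 * F) UNIV" .
  from has_sum_cmult_right [OF this, of "1 / N"]
  have "(finite_theta_term \<tau> 1 (Suc n) has_sum (1 - qpow \<tau> (int n + 1))\<^sup>2 * F / N) UNIV"
    using N by simp
  also have "(1 - qpow \<tau> (int n + 1))\<^sup>2 * F / N =
      nome_pow \<tau> (1/4) * (euler_prod \<tau> (Suc n))\<^sup>2 / euler_prod \<tau> (2 * Suc n + 1)"
    by (simp add: F_def N_def euler_prod_def power_mult_distrib add_ac mult_ac)
  finally show ?case .
qed

text \<open>
  The limit \<open>n \<rightarrow> \<infinity>\<close> in the finite identity: each reciprocal product tends to \<open>1/P\<close>, and the sum may be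
  interchanged with the limit because the terms are dominated by those of an absolutely convergent
  theta series.
\<close>

lemma jacobi_cube_identity:
  assumes "Im \<tau> > 0" and P: "euler_prod \<tau> \<longlonglongrightarrow> P" "P \<noteq> 0"
  shows "theta_moment (-1) (1/2) 1 \<tau> = nome_pow \<tau> (1/4) * P ^ 3"
proof -
  obtain C where C: "\<And>j n m. norm (finite_theta_term \<tau> j n m) \<le> norm (theta_term (-1) (1/2) j \<tau> m) * C"
    using finite_theta_term_dominated [OF assms(1)] by metis
  have inv_lim: "(\<lambda>n. inv_euler_prod \<tau> (int n + c)) \<longlonglongrightarrow> 1 / P" for c
  proof -
    have "(\<lambda>n. 1 / euler_prod \<tau> n) \<longlonglongrightarrow> 1 / P"
      by (intro tendsto_intros P)
    moreover have "filterlim (\<lambda>n. nat (int n + c)) at_top sequentially"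
      unfolding filterlim_at_top
    proof
      fix Z :: nat
      show "\<forall>\<^sub>F n in sequentially. Z \<le> nat (int n + c)"
        using eventually_ge_at_top [of "Z + nat (- c)"] by eventually_elim linarith
    qed
    ultimately have "(\<lambda>n. 1 / euler_prod \<tau> (nat (int n + c))) \<longlonglongrightarrow> 1 / P"
      by (rule filterlim_compose)
    moreover have "\<forall>\<^sub>F n in sequentially. 1 / euler_prod \<tau> (nat (int n + c)) = inv_euler_prod \<tau> (int n + c)"
      using eventually_ge_at_top [of "nat (- c)"] by eventually_elim (auto simp: inv_euler_prod_def)
    ultimately show ?thesis by (rule Lim_transform_eventually)
  qed
  have lim1: "(\<lambda>n. infsum (finite_theta_term \<tau> 1 n) UNIV) \<longlonglongrightarrow> theta_moment (-1) (1/2) 1 \<tau> * (1 / P * (1 / P))"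
  proof (rule swap_uniform_limit')
    show "\<forall>\<^sub>F X in finite_subsets_at_top UNIV. ((\<lambda>n. \<Sum>m\<in>X. finite_theta_term \<tau> 1 n m) \<longlongrightarrow>
        (\<Sum>m\<in>X. theta_term (-1) (1/2) 1 \<tau> m * (1 / P * (1 / P)))) sequentially"
      unfolding finite_theta_term_def
      using inv_lim [of "- m" for m] inv_lim [of "m + 1" for m]
      by (intro always_eventually allI tendsto_sum tendsto_mult tendsto_const) (simp_all add: add.assoc)
    show "((\<lambda>X. \<Sum>m\<in>X. theta_term (-1) (1/2) 1 \<tau> m * (1 / P * (1 / P))) \<longlongrightarrow>
        theta_moment (-1) (1/2) 1 \<tau> * (1 / P * (1 / P))) (finite_subsets_at_top UNIV)"
      using has_sum_cmult_left [OF has_sum_theta_moment [of "-1" \<tau> "1/2" 1], of "1 / P * (1 / P)"] assms(1)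
      by (simp add: has_sum_def)
    show "uniform_limit UNIV (\<lambda>X n. \<Sum>m\<in>X. finite_theta_term \<tau> 1 n m) (\<lambda>n. infsum (finite_theta_term \<tau> 1 n) UNIV)
        (finite_subsets_at_top UNIV)"
      by (rule Weierstrass_m_test_general [where M = "\<lambda>m. norm (theta_term (-1) (1/2) 1 \<tau> m) * C"])
         (use C assms(1) in \<open>auto intro!: summable_on_cmult_left abs_summable_theta_term\<close>)
  qed auto
  have "(\<lambda>n. nome_pow \<tau> (1/4) * (euler_prod \<tau> n)\<^sup>2 / euler_prod \<tau> (2 * n + 1)) \<longlonglongrightarrow> nome_pow \<tau> (1/4) * P\<^sup>2 / P"
  proof -
    have "filterlim (\<lambda>n::nat. 2 * n + 1) at_top sequentially" by real_asymp
    from filterlim_compose [OF P(1) this] show ?thesis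
      by (intro tendsto_intros P) (simp_all add: P)
  qed
  then have "(\<lambda>n. infsum (finite_theta_term \<tau> 1 n) UNIV) \<longlonglongrightarrow> nome_pow \<tau> (1/4) * P\<^sup>2 / P"
    by (simp only: infsumI [OF finite_jacobi_identity [OF assms(1)]])
  from LIMSEQ_unique [OF lim1 this] show ?thesis
    using P by (simp add: field_simps power2_eq_square power3_eq_cube)
qed

section \<open>The Weierstrass eta-function as a logarithmic derivative\<close>

text \<open>
  Both sides are the double sum of \<open>k x^(k m)\<close> over positive \<open>k\<close> and \<open>m\<close>, summed over \<open>m\<close> first and
  over \<open>k\<close> first. It converges absolutely since \<open>(k + 1)(m + 1) \<ge> k + m\<close>.
\<close>

lemma lambert_series_swap:
  fixes x :: complex
  assumes "norm x < 1"
  shows "(\<lambda>k. of_nat (Suc k) * x ^ Suc k / (1 - x ^ Suc k)) sums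
     (\<Sum>k. x ^ Suc k / (1 - x ^ Suc k)\<^sup>2)"
proof -
  define f where "f k m = of_nat (Suc k) * x ^ (Suc k * Suc m)" for k m
  have pow: "norm (x ^ Suc k) < 1" for k
    using assms power_less_one_iff [of "norm x" "Suc k"] by (simp add: norm_power del: power_Suc)
  have "summable (\<lambda>k. real (Suc k) * norm x ^ k)"
    using sums_summable [OF geometric_deriv_sums [of "norm x"]] assms by simp
  then have deriv: "(\<lambda>k. norm (of_nat (Suc k) * x ^ k)) summable_on UNIV"
    unfolding norm_mult norm_power norm_of_nat
    by (subst summable_on_UNIV_nonneg_real_iff) simp_all
  have geom: "(\<lambda>m. norm (x ^ m)) summable_on UNIV"
    unfolding norm_power
    using assms by (subst summable_on_UNIV_nonneg_real_iff) (auto intro: summable_geometric)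
  have "(\<lambda>z. norm (of_nat (Suc (fst z)) * x ^ fst z * x ^ snd z)) summable_on (UNIV :: (nat \<times> nat) set)"
    using abs_summable_times_product [OF deriv geom] .
  then have "(\<lambda>z. norm (case z of (k, m) \<Rightarrow> f k m)) summable_on UNIV"
  proof (rule Infinite_Sum.abs_summable_on_comparison_test')
    fix z :: "nat \<times> nat"
    obtain k m where z: "z = (k, m)" by fastforce
    have "norm x ^ (Suc k * Suc m) \<le> norm x ^ (k + m)"
      using assms by (intro power_decreasing) auto
    then show "norm (case z of (k, m) \<Rightarrow> f k m) \<le> norm (of_nat (Suc (fst z)) * x ^ fst z * x ^ snd z)"
      by (simp add: z f_def norm_mult norm_power power_add mult_left_mono mult.assoc del: of_nat_Suc)
  qed
  then have summable: "(\<lambda>(k, m). f k m) summable_on UNIV \<times> UNIV"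
    using abs_summable_summable by simp
  have row: "(f k has_sum of_nat (Suc k) * (x ^ Suc k / (1 - x ^ Suc k))) UNIV" for k
  proof (rule norm_summable_imp_has_sum)
    have eq: "f k m = of_nat (Suc k) * x ^ Suc k * (x ^ Suc k) ^ m" for m
      by (simp only: f_def power_mult power_Suc [of "x ^ Suc k"] mult.assoc)
    show "summable (\<lambda>m. norm (f k m))"
      unfolding eq norm_mult norm_power using pow [of k]
      by (intro summable_mult summable_geometric) (simp add: norm_mult norm_power)
    show "f k sums (of_nat (Suc k) * (x ^ Suc k / (1 - x ^ Suc k)))"
      unfolding eq using sums_mult [OF geometric_sums [OF pow [of k]], of "of_nat (Suc k) * x ^ Suc k"]
      by (simp del: power_Suc of_nat_Suc)
  qed
  have col: "((\<lambda>k. f k m) has_sum x ^ Suc m / (1 - x ^ Suc m)\<^sup>2) UNIV" for m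
  proof (rule norm_summable_imp_has_sum)
    have eq: "f k m = x ^ Suc m * (of_nat (Suc k) * (x ^ Suc m) ^ k)" for k
    proof -
      have "x ^ (Suc k * Suc m) = x ^ Suc m * (x ^ Suc m) ^ k"
        by (simp only: mult.commute [of "Suc k"] power_mult power_Suc [of "x ^ Suc m"])
      then show ?thesis
        unfolding f_def by (simp only: mult.left_commute)
    qed
    show "summable (\<lambda>k. norm (f k m))"
      unfolding eq norm_mult norm_power norm_of_nat
      using sums_summable [OF geometric_deriv_sums [of "norm (x ^ Suc m)"]] pow [of m]
      by (intro summable_mult) (simp add: norm_mult norm_power)
    show "(\<lambda>k. f k m) sums (x ^ Suc m / (1 - x ^ Suc m)\<^sup>2)"
      unfolding eq using sums_mult [OF geometric_deriv_sums [OF pow [of m]], of "x ^ Suc m"]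
      by (simp del: power_Suc of_nat_Suc)
  qed
  have rows: "((\<lambda>k. of_nat (Suc k) * (x ^ Suc k / (1 - x ^ Suc k))) has_sum infsum (\<lambda>(k, m). f k m) (UNIV \<times> UNIV)) UNIV"
    using has_sum_SigmaD [OF has_sum_infsum [OF summable], of "\<lambda>k. of_nat (Suc k) * (x ^ Suc k / (1 - x ^ Suc k))"] row
    by simp
  have swap: "((\<lambda>(m, k). f k m) has_sum infsum (\<lambda>(k, m). f k m) (UNIV \<times> UNIV)) (UNIV \<times> UNIV)"
    by (subst has_sum_reindex_bij_witness [where i = prod.swap and j = prod.swap and T = "UNIV \<times> UNIV"
         and h = "\<lambda>(k, m). f k m", OF _ _ _ _ _ refl])
       (use has_sum_infsum [OF summable] in auto)
  have cols: "((\<lambda>m. x ^ Suc m / (1 - x ^ Suc m)\<^sup>2) has_sum infsum (\<lambda>(k, m). f k m) (UNIV \<times> UNIV)) UNIV"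
    using has_sum_SigmaD [OF swap, of "\<lambda>m. x ^ Suc m / (1 - x ^ Suc m)\<^sup>2"] col by simp
  show ?thesis
    using has_sum_imp_sums [OF rows] has_sum_imp_sums [OF cols] by (simp add: sums_iff)
qed

lemma qpow_deriv: "((\<lambda>\<tau>. qpow \<tau> k) has_field_derivative 2 * \<i> * of_real pi * of_int k * qpow \<tau> k) (at \<tau>)"
  unfolding qpow_def using has_field_derivative_nome_pow [of "2 * of_int k" \<tau>] by (simp add: mult_ac)

lemma uniformly_convergent_euler_prod:
  assumes "compact K" "\<And>\<tau>. \<tau> \<in> K \<Longrightarrow> Im \<tau> \<ge> y" "y > 0"
  shows "uniformly_convergent_on K (\<lambda>n \<tau>. euler_prod \<tau> n)"
  unfolding euler_prod_def
proof (rule uniformly_convergent_on_prod')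
  show "continuous_on K (\<lambda>\<tau>. 1 - qpow \<tau> (1 + int n))" for n
    unfolding qpow_def nome_pow_def by (intro continuous_intros)
  show "uniformly_convergent_on K (\<lambda>N \<tau>. \<Sum>n<N. norm (1 - qpow \<tau> (1 + int n) - 1))"
  proof (rule Weierstrass_m_test')
    fix n \<tau> assume "\<tau> \<in> K"
    then have "pi * (2 * (1 + real n)) * y \<le> pi * (2 * (1 + real n)) * Im \<tau>"
      using assms by (intro mult_left_mono) auto
    then have "norm (qpow \<tau> (1 + int n)) \<le> exp (- (2 * pi * y)) ^ Suc n"
      by (simp add: qpow_def norm_nome_pow algebra_simps flip: exp_of_nat_mult exp_add)
    then show "norm (norm (1 - qpow \<tau> (1 + int n) - 1)) \<le> exp (- (2 * pi * y)) ^ Suc n"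
      by simp
  next
    show "summable (\<lambda>n. exp (- (2 * pi * y)) ^ Suc n)"
      using assms by (subst summable_Suc_iff) (auto intro!: summable_geometric)
  qed
qed (fact assms(1))

definition lambert_sum :: "complex \<Rightarrow> complex" where
  "lambert_sum \<tau> = (\<Sum>k. qpow \<tau> (1 + int k) / (1 - qpow \<tau> (1 + int k))\<^sup>2)"

text \<open>
  The logarithmic derivative of \<open>q^(1/4) P\<^sup>3\<close>, where \<open>P\<close> is the limit of the partial products. Their
  logarithmic derivatives are partial sums of a Lambert series, and the locally uniform convergence
  of the products allows the passage to the limit.
\<close>

lemma theta1'_logderiv:
  assumes "Im \<tau> > 0"
  shows "theta_moment (-1) (1/2) 3 \<tau> = theta_moment (-1) (1/2) 1 \<tau> * (1/4 - 6 * lambert_sum \<tau>)"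
proof -
  define r where "r = Im \<tau> / 2"
  have r: "r > 0" using assms by (simp add: r_def)
  have im: "Im w \<ge> r" if "w \<in> cball \<tau> r" for w
    using that abs_Im_le_cmod [of "\<tau> - w"] by (simp add: dist_norm r_def)
  have pos: "Im w > 0" if "w \<in> cball \<tau> r" for w
    using im [OF that] r by linarith
  obtain P where unif: "uniform_limit (cball \<tau> r) (\<lambda>n w. euler_prod w n) P sequentially"
    using uniformly_convergent_euler_prod [of "cball \<tau> r" r] im r by (auto simp: uniformly_convergent_on_def)
  have limP: "euler_prod w \<longlonglongrightarrow> P w" if "w \<in> cball \<tau> r" for w
    using tendsto_uniform_limitI [OF unif that] .
  have nzP: "P w \<noteq> 0" if "w \<in> cball \<tau> r" for w
    using euler_prod_limit_and_bound [OF pos [OF that]] LIMSEQ_unique [OF limP [OF that]] by metis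
  define d where "d w k = - (2 * \<i> * of_real pi * of_int (1 + int k) * qpow w (1 + int k)) / (1 - qpow w (1 + int k))" for w k
  have der: "((\<lambda>w. euler_prod w n) has_field_derivative euler_prod w n * (\<Sum>k<n. d w k)) (at w)"
    if "w \<in> cball \<tau> r" for w n
    unfolding euler_prod_def d_def
    using qpow_factor_nonzero [OF pos [OF that]]
    by (intro has_field_derivative_prod') (auto intro!: derivative_eq_intros qpow_deriv)
  obtain P' where P': "\<And>w. w \<in> ball \<tau> r \<Longrightarrow> (P has_field_derivative P' w) (at w) \<and>
      (\<lambda>n. euler_prod w n * (\<Sum>k<n. d w k)) \<longlonglongrightarrow> P' w"
  proof (rule has_complex_derivative_uniform_limit [OF _ unif])
    show "\<forall>\<^sub>F n in sequentially. continuous_on (cball \<tau> r) (\<lambda>w. euler_prod w n) \<and>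
        (\<forall>w\<in>ball \<tau> r. ((\<lambda>w. euler_prod w n) has_field_derivative euler_prod w n * (\<Sum>k<n. d w k)) (at w))"
      using der by (intro always_eventually allI conjI ballI DERIV_continuous_on)
        (auto intro: has_field_derivative_at_within)
  qed (use r in auto)
  have x: "norm (qpow \<tau> 1) < 1"
    using norm_qpow_less_1 [OF assms, of 1] by simp
  have q: "qpow \<tau> (1 + int k) = qpow \<tau> 1 ^ Suc k" for k
    using qpow_nat [of \<tau> "Suc k"] by simp
  have "d \<tau> sums (- (2 * \<i> * of_real pi) * lambert_sum \<tau>)"
    using sums_mult [OF lambert_series_swap [OF x], of "- (2 * \<i> * of_real pi)"]
    by (simp add: d_def [abs_def] lambert_sum_def q mult.assoc del: power_Suc)
  then have "(\<lambda>n. euler_prod \<tau> n * (\<Sum>k<n. d \<tau> k)) \<longlonglongrightarrow> P \<tau> * (- (2 * \<i> * of_real pi) * lambert_sum \<tau>)"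
    using limP [of \<tau>] r by (intro tendsto_mult) (simp_all add: sums_def)
  then have "P' \<tau> = P \<tau> * (- (2 * \<i> * of_real pi) * lambert_sum \<tau>)"
    using P' [of \<tau>] r LIMSEQ_unique by auto
  then have derP: "(P has_field_derivative P \<tau> * (- (2 * \<i> * of_real pi) * lambert_sum \<tau>)) (at \<tau>)"
    using P' [of \<tau>] r by simp
  have cube: "theta_moment (-1) (1/2) 1 w = nome_pow w (1/4) * P w ^ 3" if "w \<in> cball \<tau> r" for w
    using jacobi_cube_identity [OF pos limP nzP] that by blast
  have der_cube: "((\<lambda>w. nome_pow w (1/4) * P w ^ 3) has_field_derivative
      \<i> * of_real pi * of_real (1/4) * nome_pow \<tau> (1/4) * P \<tau> ^ 3 +
      nome_pow \<tau> (1/4) * (3 * P \<tau> ^ 2 * (P \<tau> * (- (2 * \<i> * of_real pi) * lambert_sum \<tau>)))) (at \<tau>)"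
    by (auto intro!: derivative_eq_intros derP has_field_derivative_nome_pow)
  have der_moment: "(theta_moment (-1) (1/2) 1 has_field_derivative \<i> * of_real pi * theta_moment (-1) (1/2) 3 \<tau>) (at \<tau>)"
    using has_field_derivative_theta_moment [of "-1" \<tau> "1/2" 1] assms by (simp add: numeral_3_eq_3)
  have "\<i> * of_real pi * theta_moment (-1) (1/2) 3 \<tau> =
      \<i> * of_real pi * of_real (1/4) * nome_pow \<tau> (1/4) * P \<tau> ^ 3 +
      nome_pow \<tau> (1/4) * (3 * P \<tau> ^ 2 * (P \<tau> * (- (2 * \<i> * of_real pi) * lambert_sum \<tau>)))"
    by (rule has_field_derivative_unique_on_open [OF der_moment der_cube, of "ball \<tau> r"]) (use cube r in auto)
  also have "\<dots> = \<i> * of_real pi * (nome_pow \<tau> (1/4) * P \<tau> ^ 3 * (1/4 - 6 * lambert_sum \<tau>))"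
    by (simp add: field_simps power2_eq_square power3_eq_cube)
  also have "nome_pow \<tau> (1/4) * P \<tau> ^ 3 = theta_moment (-1) (1/2) 1 \<tau>"
    using cube [of \<tau>] r by simp
  finally show ?thesis by simp
qed

text \<open>
  Two evaluations of \<open>D log \<phi>\<close>: one from the product, containing the Lambert series of \<open>\<eta>\<close>, the other
  from \<open>2 \<phi> = \<theta>\<^sub>2 \<theta>\<^sub>3 \<theta>\<^sub>4\<close> and the known differences of logarithmic derivatives.
\<close>

lemma weierstrass_eta_eq:
  assumes "Im \<tau> > 0"
  shows "weierstrass_eta \<tau> = of_real pi ^ 2 / 12 * (12 * theta4_logderiv \<tau> + theta2 \<tau> ^ 4 + theta3 \<tau> ^ 4)"
proof -
  have nz: "theta2 \<tau> \<noteq> 0" "theta3 \<tau> \<noteq> 0" "theta4 \<tau> \<noteq> 0"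
    using assms theta2_nonzero theta3_theta4_nonzero by auto
  have "((\<lambda>\<tau>. theta2 \<tau> * theta3 \<tau> * theta4 \<tau>) has_field_derivative
      \<i> * of_real pi * theta_moment 1 (1/2) 2 \<tau> * theta3 \<tau> * theta4 \<tau> +
      theta2 \<tau> * (\<i> * of_real pi * theta_moment 1 0 2 \<tau>) * theta4 \<tau> +
      theta2 \<tau> * theta3 \<tau> * (\<i> * of_real pi * theta_moment (-1) 0 2 \<tau>)) (at \<tau>)"
    by (auto intro!: derivative_eq_intros theta_deriv assms simp: algebra_simps)
  moreover have "((\<lambda>\<tau>. 2 * theta_moment (-1) (1/2) 1 \<tau>) has_field_derivative
      2 * (\<i> * of_real pi * theta_moment (-1) (1/2) 3 \<tau>)) (at \<tau>)"
    using has_field_derivative_theta_moment [of "-1" \<tau> "1/2" 1] assms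
    by (intro DERIV_cmult) (simp add: numeral_3_eq_3)
  ultimately have "2 * (\<i> * of_real pi * theta_moment (-1) (1/2) 3 \<tau>) =
      \<i> * of_real pi * theta_moment 1 (1/2) 2 \<tau> * theta3 \<tau> * theta4 \<tau> +
      theta2 \<tau> * (\<i> * of_real pi * theta_moment 1 0 2 \<tau>) * theta4 \<tau> +
      theta2 \<tau> * theta3 \<tau> * (\<i> * of_real pi * theta_moment (-1) 0 2 \<tau>)"
    using has_field_derivative_unique_on_open [OF _ _ open_upper_half_plane] assms jacobi_derivative_formula
    by (auto simp: upper_half_plane_def)
  also have "\<dots> = \<i> * of_real pi * (theta2 \<tau> * theta3 \<tau> * theta4 \<tau> *
      (3 * theta4_logderiv \<tau> + (theta2 \<tau> ^ 4 + theta3 \<tau> ^ 4) / 4))"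
    unfolding theta2_moment2 [OF assms] theta3_moment2 [OF assms] theta4_moment2 [OF assms]
    by (simp add: field_simps)
  also have "2 * (\<i> * of_real pi * theta_moment (-1) (1/2) 3 \<tau>) =
      \<i> * of_real pi * ((2 * theta_moment (-1) (1/2) 1 \<tau>) * (1/4 - 6 * lambert_sum \<tau>))"
    unfolding theta1'_logderiv [OF assms] by simp
  finally have "1/4 - 6 * lambert_sum \<tau> = 3 * theta4_logderiv \<tau> + (theta2 \<tau> ^ 4 + theta3 \<tau> ^ 4) / 4"
    unfolding jacobi_derivative_formula [OF assms] using nz by simp
  then have "4 * (1/4 - 6 * lambert_sum \<tau>) = 12 * theta4_logderiv \<tau> + theta2 \<tau> ^ 4 + theta3 \<tau> ^ 4"
    by (simp only:) simp
  then have "12 * theta4_logderiv \<tau> + theta2 \<tau> ^ 4 + theta3 \<tau> ^ 4 = 24 * (1/24 - lambert_sum \<tau>)"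
    by simp
  moreover have "weierstrass_eta \<tau> = 2 * of_real pi ^ 2 * (1/24 - lambert_sum \<tau>)"
    by (simp add: weierstrass_eta_def lambert_sum_def qpow_def nome_pow_def)
  ultimately show ?thesis by simp
qed

section \<open>The differential system\<close>

theorem proposition1:
  fixes \<tau> :: complex
  assumes "\<tau> \<in> upper_half_plane"
  shows
    "(theta2 has_field_derivative
        \<i> / of_real pi * (weierstrass_eta \<tau> + of_real pi ^ 2 / 12 *
          (theta3 \<tau> ^ 4 + theta4 \<tau> ^ 4)) * theta2 \<tau>) (at \<tau>) \<and>
     (theta3 has_field_derivative
        \<i> / of_real pi * (weierstrass_eta \<tau> + of_real pi ^ 2 / 12 *
          (theta2 \<tau> ^ 4 - theta4 \<tau> ^ 4)) * theta3 \<tau>) (at \<tau>) \<and>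
     (theta4 has_field_derivative
        \<i> / of_real pi * (weierstrass_eta \<tau> - of_real pi ^ 2 / 12 *
          (theta2 \<tau> ^ 4 + theta3 \<tau> ^ 4)) * theta4 \<tau>) (at \<tau>) \<and>
     (weierstrass_eta has_field_derivative
        \<i> / of_real pi * (2 * weierstrass_eta \<tau> ^ 2 - of_real pi ^ 4 / 12 ^ 2 *
          (theta2 \<tau> ^ 8 + theta3 \<tau> ^ 8 + theta4 \<tau> ^ 8))) (at \<tau>)"
proof (intro conjI)
  have \<tau>: "Im \<tau> > 0"
    using assms by (simp add: upper_half_plane_def)
  define p A B where "p = theta4_logderiv \<tau>" and "A = theta2 \<tau> ^ 4" and "B = theta3 \<tau> ^ 4"
  have C: "theta4 \<tau> ^ 4 = B - A"
    using jacobi_quartic_identity [OF \<tau>] by (simp add: A_def B_def)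
  have eta: "weierstrass_eta \<tau> = of_real pi ^ 2 / 12 * (12 * p + A + B)"
    using weierstrass_eta_eq [OF \<tau>] by (simp add: p_def A_def B_def)
  show "(theta2 has_field_derivative \<i> / of_real pi * (weierstrass_eta \<tau> + of_real pi ^ 2 / 12 *
          (theta3 \<tau> ^ 4 + theta4 \<tau> ^ 4)) * theta2 \<tau>) (at \<tau>)"
    using theta2_deriv [OF \<tau>] unfolding theta2_moment2 [OF \<tau>] p_def [symmetric] A_def [symmetric] B_def [symmetric] eta C
    by (rule DERIV_cong) (simp add: field_simps power2_eq_square)
  show "(theta3 has_field_derivative \<i> / of_real pi * (weierstrass_eta \<tau> + of_real pi ^ 2 / 12 *
          (theta2 \<tau> ^ 4 - theta4 \<tau> ^ 4)) * theta3 \<tau>) (at \<tau>)"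
    using theta3_deriv [OF \<tau>] unfolding theta3_moment2 [OF \<tau>] p_def [symmetric] A_def [symmetric] B_def [symmetric] eta C
    by (rule DERIV_cong) (simp add: field_simps power2_eq_square)
  show "(theta4 has_field_derivative \<i> / of_real pi * (weierstrass_eta \<tau> - of_real pi ^ 2 / 12 *
          (theta2 \<tau> ^ 4 + theta3 \<tau> ^ 4)) * theta4 \<tau>) (at \<tau>)"
    using theta4_deriv [OF \<tau>] unfolding theta4_moment2 [OF \<tau>] p_def [symmetric] A_def [symmetric] B_def [symmetric] eta
    by (rule DERIV_cong) (simp add: field_simps power2_eq_square)
  \<comment> \<open>with \<open>C = \<theta>\<^sub>4\<^sup>4 = B - A\<close> everything becomes polynomial in \<open>p\<close>, \<open>A\<close>, \<open>B\<close>\<close>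
  have eighth: "theta2 \<tau> ^ 8 = A\<^sup>2" "theta3 \<tau> ^ 8 = B\<^sup>2" "theta4 \<tau> ^ 8 = (theta4 \<tau> ^ 4)\<^sup>2"
    by (simp_all add: A_def B_def flip: power_mult)
  define w where "w = theta_moment (-1) 0 4 \<tau> / theta4 \<tau>"
  have w: "w = 3 * p\<^sup>2 - A * B / 8"
    using theta4_second_bracket [OF \<tau>] by (simp add: w_def p_def A_def B_def)
  have d2: "theta2 \<tau> ^ 3 * theta_moment 1 (1/2) 2 \<tau> = A * (p + B / 4)"
    unfolding theta2_moment2 [OF \<tau>] p_def A_def B_def by (simp add: eval_nat_numeral)
  have d3: "theta3 \<tau> ^ 3 * theta_moment 1 0 2 \<tau> = B * (p + A / 4)"
    unfolding theta3_moment2 [OF \<tau>] p_def A_def B_def by (simp add: eval_nat_numeral)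
  have "((\<lambda>\<tau>. of_real pi ^ 2 / 12 * (12 * theta4_logderiv \<tau> + theta2 \<tau> ^ 4 + theta3 \<tau> ^ 4)) has_field_derivative
      of_real pi ^ 2 / 12 * (\<i> * of_real pi) * (12 * (w - p\<^sup>2) +
        4 * (theta2 \<tau> ^ 3 * theta_moment 1 (1/2) 2 \<tau>) +
        4 * (theta3 \<tau> ^ 3 * theta_moment 1 0 2 \<tau>))) (at \<tau>)"
    unfolding w_def p_def
    by (rule derivative_eq_intros refl theta_deriv theta4_logderiv_deriv \<tau>)+
       (simp add: algebra_simps)
  then have "((\<lambda>\<tau>. of_real pi ^ 2 / 12 * (12 * theta4_logderiv \<tau> + theta2 \<tau> ^ 4 + theta3 \<tau> ^ 4)) has_field_derivative
      \<i> / of_real pi * (2 * weierstrass_eta \<tau> ^ 2 - of_real pi ^ 4 / 12 ^ 2 *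
          (theta2 \<tau> ^ 8 + theta3 \<tau> ^ 8 + theta4 \<tau> ^ 8))) (at \<tau>)"
    unfolding d2 d3 eta eighth w C
    by (rule DERIV_cong) (simp add: field_simps power2_eq_square power4_eq_xxxx)
  then show "(weierstrass_eta has_field_derivative \<i> / of_real pi * (2 * weierstrass_eta \<tau> ^ 2 -
      of_real pi ^ 4 / 12 ^ 2 * (theta2 \<tau> ^ 8 + theta3 \<tau> ^ 8 + theta4 \<tau> ^ 8))) (at \<tau>)"
    by (rule has_field_derivative_transform_within_open [OF _ open_upper_half_plane assms])
       (simp add: weierstrass_eta_eq upper_half_plane_def)
qed

end
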